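(* Let $d \ge 1$ and let $C_1, C_2 \subset \mathbb{R}^d$ be compact sets such that $\tau(C_1)\tau(C_2) > 1$, where $\tau$ denotes thickness. Then for every $k \ge 1$, every tree $T^k$ with $k+1$ vertices (hence $k$ edges), and every pin $x \in C_1 \times C_2$, the pinned tree distance set $\Delta_{T_x^k}(C_1 \times C_2) \subset \mathbb{R}^k$ has non-empty interior in $\mathbb{R}^k$.
   Context: A tree is a connected acyclic graph. Let $T^k$ be a tree on the vertex set $\{1, \dots, k+1\}$, and write $i \sim j$ when $i$ and $j$ are adjacent. For $B \subset \mathbb{R}^{m}$ and $x \in B$, the pinned tree distance set is $$\Delta_{T_x^k}(B) := \left\{ (|x^i - x^j|)_{i \sim j} : x^1, \dots, x^{k+1} \in B,\ x^i \ne x^j \text{ for } i \neq j,\ x = x^i \text{ for some } i \right\},$$ where $(a_{i,j})_{i\sim j}$ denotes a vector in $\mathbb{R}^k$ with coordinates indexed by the edges of $T^k$, and $|\cdot|$ is the Euclidean norm. Gaps: for a compact set $C \subset \mathbb{R}^d$, let $\{G_n\}_{n\ge 1}$ be the (at most countably many) bounded open path-connected components of the complement of $C$ (the bounded gaps), ordered by non-increasing diameter, and let $E$ be the unbounded open path-connected component of the complement of $C$ (the unbounded gap; when $d=1$, $E$ is the union of the two unbounded intervals). Thickness: if $C$ has at least one bounded gap, $$\tau(C) := \inf_{n} \frac{\operatorname{dist}\left(G_n, \bigcup_{1 \le i \le n-1} G_i \cup E\right)}{\operatorname{diam}(G_n)}.$$ If $C$ has no bounded gap, then $\tau(C) = +\infty$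 if $C$ has non-empty interior and $\tau(C) = 0$ if $C$ has empty interior. Here $\operatorname{dist}$ is the usual (infimum) distance between non-empty subsets. Convention: $0 \cdot \infty = 0$. *)

theory Defs
  imports "HOL-Analysis.Analysis"
begin

section \<open>Gaps and thickness\<close>

definition gaps :: "'a::euclidean_space set \<Rightarrow> 'a set set" where
  "gaps C = path_component_set (- C) ` (- C)"

definition bounded_gaps :: "'a::euclidean_space set \<Rightarrow> 'a set set" where
  "bounded_gaps C = {G \<in> gaps C. bounded G}"

text \<open>For compact \<open>C\<close> this is a single component in dimension at least two, and the union of
  the two unbounded intervals in dimension one.\<close>

definition unbounded_gap :: "'a::euclidean_space set \<Rightarrow> 'a set" where
  "unbounded_gap C = \<Union> {G \<in> gaps C. \<not> bounded G}"

text \<open>An enumeration \<open>G\<^sub>1, G\<^sub>2, \<dots>\<close> without repetition, finite or infinite, of all bounded gaps,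
  by non-increasing diameter.\<close>

definition gap_ordering :: "'a::euclidean_space set \<Rightarrow> nat set \<Rightarrow> (nat \<Rightarrow> 'a set) \<Rightarrow> bool" where
  "gap_ordering C I G \<longleftrightarrow>
     (I = {1..} \<or> (\<exists>N. I = {1..N})) \<and>
     bij_betw G I (bounded_gaps C) \<and>
     (\<forall>m\<in>I. \<forall>n\<in>I. m \<le> n \<longrightarrow> diameter (G n) \<le> diameter (G m))"

definition thickness_along :: "'a::euclidean_space set \<Rightarrow> nat set \<Rightarrow> (nat \<Rightarrow> 'a set) \<Rightarrow> ennreal" where
  "thickness_along C I G =
     (INF n\<in>I. ennreal (setdist (G n) ((\<Union>i\<in>{1..<n}. G i) \<union> unbounded_gap C) / diameter (G n)))"

text \<open>The value does not depend on the choice among gaps of equal diameter (see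
  \<open>thickness_along_unique\<close> below), so the description is well-defined.  In dimension at least two the
  bounded gaps of a compact set need not admit an ordering by non-increasing diameter at all
  (say, with diameters \<open>1 - 1/n\<close> for \<open>n \<ge> 2\<close>).  Then infinitely many gaps have diameter
  at least some \<open>\<epsilon> > 0\<close>; lying in a bounded region, they come arbitrarily close to each other, so
  that the ratios of distance to diameter have infimum 0.  Accordingly the thickness is 0 in this
  case.  In \<open>ennreal\<close>, \<open>0 * \<infinity> = 0\<close>.\<close>

definition thickness :: "'a::euclidean_space set \<Rightarrow> ennreal" where
  "thickness C =
     (if bounded_gaps C = {} then (if interior C \<noteq> {} then \<infinity> else 0)
      else if \<exists>I G. gap_ordering C I G
        then (THE t. \<exists>I G. gap_ordering C I G \<and> t = thickness_along C I G)
      else 0)"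

lemma unbounded_gap_nonempty:
  fixes C :: "'a::euclidean_space set"
  assumes "compact C"
  shows "unbounded_gap C \<noteq> {}"
proof -
  have "bounded (- (- C))" using assms by (simp add: compact_imp_bounded)
  then obtain x where x: "x \<in> - C" "\<not> bounded (connected_component_set (- C) x)"
    using cobounded_unbounded_component by blast
  have "open (- C)" using assms by (simp add: compact_imp_closed open_Compl)
  then have "\<not> bounded (path_component_set (- C) x)"
    using x open_path_connected_component_set by metis
  moreover have "path_component_set (- C) x \<in> gaps C" using x by (simp add: gaps_def)
  moreover have "x \<in> path_component_set (- C) x" using x by (simp add: path_component_refl)
  ultimately show ?thesis unfolding unbounded_gap_def by blast
qed

lemma thickness_along_le:
  fixes C :: "'a::euclidean_space set"
  assumes C: "compact C" and G: "gap_ordering C I G" and H: "gap_ordering C J H"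
  shows "thickness_along C I G \<le> thickness_along C J H"
  unfolding thickness_along_def[of C J H]
proof (rule INF_greatest)
  fix m assume m: "m \<in> J"
  have pos: "n \<in> I \<Longrightarrow> 1 \<le> n" for n using G by (auto simp: gap_ordering_def)
  have posJ: "n \<in> J \<Longrightarrow> 1 \<le> n" for n using H by (auto simp: gap_ordering_def)
  have downJ: "1 \<le> j \<Longrightarrow> j < m \<Longrightarrow> j \<in> J" for j
    using H m by (auto simp: gap_ordering_def)
  have ex: "\<exists>i\<in>I. G i = H j" if "j \<in> J" for j
    using G H that unfolding gap_ordering_def bij_betw_def by (metis imageE imageI)
  have injH: "inj_on H J" using H by (simp add: gap_ordering_def bij_betw_def)
  obtain n where n: "n \<in> I" "G n = H m" using ex m by blast
  have ne: "H j \<noteq> {}" if "j \<in> J" for j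
  proof -
    have "H j \<in> gaps C" using H that
      by (auto simp: gap_ordering_def bij_betw_def bounded_gaps_def)
    then show ?thesis using path_component_refl[of _ "- C"] by (fastforce simp: gaps_def)
  qed
  have term_le: "thickness_along C I G \<le> ennreal (dist x y / diameter (G i))"
    if "i \<in> I" "x \<in> G i" "y \<in> (\<Union>l\<in>{1..<i}. G l) \<union> unbounded_gap C" for i x y
  proof -
    have d: "0 \<le> diameter (G i)"
      using G that by (auto simp: gap_ordering_def bij_betw_def bounded_gaps_def
          intro!: diameter_ge_0)
    have "thickness_along C I G
        \<le> ennreal (setdist (G i) ((\<Union>l\<in>{1..<i}. G l) \<union> unbounded_gap C) / diameter (G i))"
      unfolding thickness_along_def using that by (intro INF_lower)
    also have "\<dots> \<le> ennreal (dist x y / diameter (G i))"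
      by (intro ennreal_leI divide_right_mono setdist_le_dist that d)
    finally show ?thesis .
  qed
  define A where "A = (\<Union>i\<in>{1..<m}. H i) \<union> unbounded_gap C"
  have key: "thickness_along C I G \<le> ennreal (dist x y / diameter (H m))"
    if x: "x \<in> H m" and y: "y \<in> A" for x y
  proof (cases "y \<in> unbounded_gap C")
    case True
    then show ?thesis using term_le[of n x y] n x by simp
  next
    case False
    then obtain j where j: "1 \<le> j" "j < m" "y \<in> H j" using y by (auto simp: A_def)
    have jJ: "j \<in> J" using j downJ by blast
    obtain i where i: "i \<in> I" "G i = H j" using ex jJ by blast
    have "i \<noteq> n" using i n j injH jJ m by (metis inj_on_contraD less_irrefl)
    then consider "i < n" | "n < i" by linarith
    then show ?thesis
    proof cases
      case 1
      have "y \<in> (\<Union>l\<in>{1..<n}. G l)" using 1 i j pos by auto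
      then show ?thesis using term_le[of n x y] n x by simp
    next
      case 2
      have "diameter (G i) \<le> diameter (G n)" using G i(1) n(1) 2 unfolding gap_ordering_def by (meson less_imp_le)
      moreover have "diameter (H m) \<le> diameter (H j)"
        using H jJ m j(2) unfolding gap_ordering_def by (meson less_imp_le)
      ultimately have eq: "diameter (G i) = diameter (H m)" using i n by simp
      have "x \<in> (\<Union>l\<in>{1..<i}. G l)" using 2 n x pos by auto
      then show ?thesis using term_le[of i y x] i j eq by (simp add: dist_commute)
    qed
  qed
  have Ane: "A \<noteq> {}" using unbounded_gap_nonempty[OF C] by (simp add: A_def)
  have d: "0 < diameter (H m)"
  proof -
    have "H m \<in> bounded_gaps C" using H m by (auto simp: gap_ordering_def bij_betw_def)
    then have b: "bounded (H m)" and g: "H m \<in> gaps C" by (auto simp: bounded_gaps_def)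
    have "open (- C)" using C by (simp add: compact_imp_closed open_Compl)
    then have "open (H m)" using g by (auto simp: gaps_def open_path_component)
    then have "interior (H m) \<noteq> {}" using ne[OF m] by (simp add: interior_open)
    then obtain x e where xe: "0 < e" "cball x e \<subseteq> H m"
      by (metis ex_in_conv mem_interior_cball)
    have "diameter (cball x e) \<le> diameter (H m)" by (rule diameter_subset[OF xe(2) b])
    then show ?thesis using xe by simp
  qed
  obtain x0 y0 where xy0: "x0 \<in> H m" "y0 \<in> A" using ne[OF m] Ane by blast
  have "thickness_along C I G \<noteq> top"
    using key[OF xy0] by (metis ennreal_neq_top neq_top_trans)
  then obtain t where t: "thickness_along C I G = ennreal t" "0 \<le> t"
    by (cases "thickness_along C I G") auto
  have "t * diameter (H m) \<le> setdist (H m) A"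
  proof (rule le_setdistI)
    fix x y assume "x \<in> H m" "y \<in> A"
    from key[OF this] have "t \<le> dist x y / diameter (H m)"
      using t d by (simp add: ennreal_le_iff)
    then show "t * diameter (H m) \<le> dist x y" using d by (simp add: field_simps)
  qed (use ne[OF m] Ane in auto)
  then have "t \<le> setdist (H m) A / diameter (H m)" using d by (simp add: field_simps)
  then show "thickness_along C I G
      \<le> ennreal (setdist (H m) ((\<Union>i\<in>{1..<m}. H i) \<union> unbounded_gap C) / diameter (H m))"
    unfolding t A_def[symmetric] by (rule ennreal_leI)
qed

lemma thickness_along_unique:
  assumes "compact C" "gap_ordering C I G" "gap_ordering C J H"
  shows "thickness_along C I G = thickness_along C J H"
  using thickness_along_le assms by (metis order_antisym)

lemma thickness_eq:
  assumes "compact C" "gap_ordering C I G" "bounded_gaps C \<noteq> {}"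
  shows "thickness C = thickness_along C I G"
proof -
  have "(THE t. \<exists>I G. gap_ordering C I G \<and> t = thickness_along C I G) = thickness_along C I G"
    using assms thickness_along_unique by (intro the_equality) blast+
  then show ?thesis using assms by (auto simp: thickness_def)
qed

section \<open>Trees and pinned tree distance sets\<close>

definition simple_graph :: "'v set \<Rightarrow> ('v \<Rightarrow> 'v \<Rightarrow> bool) \<Rightarrow> bool" where
  "simple_graph V adj \<longleftrightarrow>
     (\<forall>i j. adj i j \<longrightarrow> i \<in> V \<and> j \<in> V \<and> i \<noteq> j \<and> adj j i)"

definition connected_graph :: "'v set \<Rightarrow> ('v \<Rightarrow> 'v \<Rightarrow> bool) \<Rightarrow> bool" where
  "connected_graph V adj \<longleftrightarrow> V \<noteq> {} \<and> (\<forall>i\<in>V. \<forall>j\<in>V. adj\<^sup>*\<^sup>* i j)"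

definition graph_cycle :: "('v \<Rightarrow> 'v \<Rightarrow> bool) \<Rightarrow> 'v list \<Rightarrow> bool" where
  "graph_cycle adj p \<longleftrightarrow>
     3 \<le> length p \<and> distinct p \<and> (\<forall>i<length p. adj (p ! i) (p ! (Suc i mod length p)))"

definition tree :: "'v set \<Rightarrow> ('v \<Rightarrow> 'v \<Rightarrow> bool) \<Rightarrow> bool" where
  "tree V adj \<longleftrightarrow> simple_graph V adj \<and> connected_graph V adj \<and> (\<nexists>p. graph_cycle adj p)"

text \<open>Each undirected edge is represented once, by its endpoints in increasing order.\<close>

definition graph_edges :: "(nat \<Rightarrow> nat \<Rightarrow> bool) \<Rightarrow> (nat \<times> nat) set" where
  "graph_edges adj = {(i, j). i < j \<and> adj i j}"

text \<open>A vector with coordinates indexed by the edges is an extensional function on the edge set,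
  that is, a point of the space \<open>powertop_real (graph_edges adj)\<close>.\<close>

definition pinned_tree_distance_set ::
  "nat \<Rightarrow> (nat \<Rightarrow> nat \<Rightarrow> bool) \<Rightarrow> 'b::real_normed_vector \<Rightarrow> 'b set \<Rightarrow> (nat \<times> nat \<Rightarrow> real) set" where
  "pinned_tree_distance_set k adj x B =
     {(\<lambda>(i, j)\<in>graph_edges adj. norm (X i - X j)) | X.
        X ` {1..k+1} \<subseteq> B \<and> inj_on X {1..k+1} \<and> (\<exists>i\<in>{1..k+1}. x = X i)}"

end

theory Submission
  imports Defs
begin

text \<open>
  Let \<open>B = C1 \<times> C2\<close>.  The theorem follows from a statement about a single edge
  (\<open>robustly_leaves\<close>): from every \<open>y \<in> B\<close> there are infinitely many \<open>z \<in> B\<close> such that,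
  with the second endpoint confined to any prescribed neighbourhood of \<open>z\<close>, an interval of distances
  is realized from all points near \<open>y\<close> at once.  Given this, reference positions of the vertices
  are chosen one after the other along the tree, and then tolerances in the reverse order; as a tree
  has no cycles, each new vertex has to satisfy only one distance condition
  (\<open>pinned_tree_distance_set_interior\<close>).

  If \<open>C1\<close> has an interior point \<open>u\<close>, the points near \<open>u\<close> in the first factor already give an
  interval of distances, with the second coordinate fixed, and similarly for \<open>C2\<close>.  A set without
  interior and of positive thickness has bounded gaps, and then the dimension matters.

  In dimension at least two the second coordinate is again kept fixed.  The outer boundary of a
  bounded gap, the frontier of the outside of its closure, is a connected subset of \<open>C1\<close>.
  Positive thickness keeps a gap away from the unbounded gap and lets other gaps come close to it
  only if they are small.  So arbitrarily small gaps accumulate at each point of the outer boundary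
  of a gap, and the outer boundaries of the small gaps are arbitrarily small continua.  None of
  them lies on a sphere about a point away from it, and so the distances from such a point to
  a continuum form a nondegenerate interval (\<open>robustly_leaves_dim_ge_2\<close>).

  In dimension one the condition on the product enters through Newhouse's gap lemma: compact sets
  of reals with thicknesses of product greater than 1 and linked hulls meet
  (\<open>thick_sets_with_linked_hulls_meet\<close>).  The points of \<open>C1 \<times> C2\<close> at distance \<open>s\<close> from
  \<open>(a, b)\<close> are the solutions of \<open>(u - a)\<^sup>2 = s\<^sup>2 - (v - b)\<^sup>2\<close>.  Near right endpoints \<open>q1 > a\<close>
  and \<open>q2 > b\<close> of gaps both sides are nearly linear, so that the images of suitable small pieces
  of \<open>C1\<close> and \<open>C2\<close> under them have almost the original thicknesses.  The hulls of the images
  are linked for an open set of values of \<open>s\<close>, and this persists when \<open>(a, b)\<close> moves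
  a little (\<open>sum_of_squares_near_gap_endpoints\<close>).
\<close>

section \<open>Thick compact sets of reals\<close>

definition is_gap :: "real set \<Rightarrow> real \<Rightarrow> real \<Rightarrow> bool" where
  "is_gap S p q \<longleftrightarrow> p < q \<and> p \<in> S \<and> q \<in> S \<and> {p<..<q} \<inter> S = {}"

text \<open>Of two gaps only the smaller one is compared with their distance, so no enumeration of the
  gaps by size is involved.  The two unbounded gaps count as larger than any bounded one; naming
  the extreme points \<open>m\<close> and \<open>M\<close> keeps track of them.\<close>

definition thick :: "real \<Rightarrow> real \<Rightarrow> real \<Rightarrow> real set \<Rightarrow> bool" where
  "thick t m M S \<longleftrightarrow> compact S \<and> m \<in> S \<and> M \<in> S \<and> S \<subseteq> {m..M} \<and>
     (\<forall>p q. is_gap S p q \<longrightarrow> t * (q - p) \<le> p - m \<and> t * (q - p) \<le> M - q) \<and>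
     (\<forall>p q p' q'. is_gap S p q \<longrightarrow> is_gap S p' q' \<longrightarrow> q \<le> p' \<longrightarrow> t * min (q - p) (q' - p') \<le> p' - q)"

lemma thickD:
  assumes "thick t m M S"
  shows "compact S" "m \<in> S" "M \<in> S" "\<And>x. x \<in> S \<Longrightarrow> m \<le> x \<and> x \<le> M"
    "\<And>p q. is_gap S p q \<Longrightarrow> t * (q - p) \<le> p - m"
    "\<And>p q. is_gap S p q \<Longrightarrow> t * (q - p) \<le> M - q"
    "\<And>p q p' q'. is_gap S p q \<Longrightarrow> is_gap S p' q' \<Longrightarrow> q \<le> p' \<Longrightarrow> t * min (q - p) (q' - p') \<le> p' - q"
  using assms unfolding thick_def by auto

lemma gap_around:
  assumes S: "compact S" and l: "l \<in> S" "l < x" and u: "u \<in> S" "x < u" and x: "x \<notin> S"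
  obtains p q where "is_gap S p q" "l \<le> p" "p < x" "x < q" "q \<le> u"
proof -
  have c: "compact (S \<inter> {l..x})" "compact (S \<inter> {x..u})"
    using S by (auto intro: compact_Int_closed)
  have ne: "S \<inter> {l..x} \<noteq> {}" "S \<inter> {x..u} \<noteq> {}" using l u by auto
  obtain p where p: "p \<in> S \<inter> {l..x}" "\<And>y. y \<in> S \<inter> {l..x} \<Longrightarrow> y \<le> p"
    using compact_attains_sup[OF c(1) ne(1)] by blast
  obtain q where q: "q \<in> S \<inter> {x..u}" "\<And>y. y \<in> S \<inter> {x..u} \<Longrightarrow> q \<le> y"
    using compact_attains_inf[OF c(2) ne(2)] by blast
  have px: "p < x" and xq: "x < q" using p(1) q(1) x by (auto simp: less_le)
  have "False" if "y \<in> S" "p < y" "y < q" for y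
  proof (cases "y \<le> x")
    case True
    then show False using p(2)[of y] p(1) that by auto
  next
    case False
    then show False using q(2)[of y] q(1) that by auto
  qed
  then have "is_gap S p q" using p(1) q(1) px xq by (auto simp: is_gap_def)
  then show ?thesis using that p(1) q(1) px xq by auto
qed

subsection \<open>The gap lemma\<close>

text \<open>Two gaps \<open>U = (p, q)\<close> of \<open>A\<close> and \<open>V = (p', q')\<close> of \<open>B\<close> that overlap without being nested
  always produce another such pair of smaller total length.  Indeed \<open>t1 * t2 > 1\<close> forces
  \<open>t1 * |U| > |V|\<close> or \<open>t2 * |V| > |U|\<close>.  In the first case the endpoint \<open>q'\<close> of \<open>V\<close> is so close to
  \<open>U\<close> that the gap of \<open>A\<close> around it is bounded and smaller than \<open>U\<close>; it is linked with \<open>V\<close>.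
  The second case is the mirror image.  In both cases the order of the two linked gaps is reversed,
  which swaps the roles of \<open>A\<close> and \<open>B\<close>.  As the sets have distance at least \<open>\<rho>\<close>, each step loses
  at least the length \<open>\<kappa>\<close>, and the descent ends.\<close>

lemma no_linked_gaps:
  assumes "thick t1 m1 M1 A" "thick t2 m2 M2 B" "0 < t1" "0 < t2" "1 < t1 * t2"
    and "\<And>a b. a \<in> A \<Longrightarrow> b \<in> B \<Longrightarrow> \<rho> \<le> \<bar>a - b\<bar>" "0 < \<rho>"
    and "0 < \<kappa>" "t1 * \<kappa> \<le> \<rho>" "t2 * \<kappa> \<le> \<rho>"
    and "is_gap A p q" "is_gap B p' q'" "p < p'" "p' < q" "q < q'"
  shows "\<not> (q - p) + (q' - p') \<le> real n * \<kappa>"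
  using assms
proof (induction n arbitrary: A B t1 t2 m1 m2 M1 M2 p q p' q')
  case 0
  then show ?case by (simp add: is_gap_def)
next
  case (Suc n A B t1 t2 m1 m2 M1 M2 p q p' q')
  note A = thickD[OF Suc.prems(1)] and B = thickD[OF Suc.prems(2)]
  note t1 = Suc.prems(3) and t2 = Suc.prems(4) and t12 = Suc.prems(5)
    and sep = Suc.prems(6) and \<rho> = Suc.prems(7) and \<kappa> = Suc.prems(8-10)
    and gA = Suc.prems(11) and gB = Suc.prems(12) and ord = Suc.prems(13-15)
  have mem: "p \<in> A" "q \<in> A" "p' \<in> B" "q' \<in> B" using gA gB by (auto simp: is_gap_def)
  have sep': "\<rho> \<le> \<bar>b - a\<bar>" if "a \<in> A" "b \<in> B" for a b using sep[OF that] by linarith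
  have qp': "\<rho> \<le> q - p'" using sep[OF mem(2,3)] ord by linarith
  have dis: "x \<notin> B" if "x \<in> A" for x using sep[OF that, of x] \<rho> by auto
  have dis': "x \<notin> A" if "x \<in> B" for x using dis that by blast
  have comm: "1 < t2 * t1" using t12 by (simp add: mult.commute)
  have "q' - p' < t1 * (q - p) \<or> q - p < t2 * (q' - p')"
  proof (rule ccontr)
    assume "\<not> ?thesis"
    then have 1: "t1 * (q - p) \<le> q' - p'" and 2: "t2 * (q' - p') \<le> q - p" by auto
    have "(t1 * t2) * (q - p) = t2 * (t1 * (q - p))" by simp
    also have "\<dots> \<le> t2 * (q' - p')" using 1 t2 by (intro mult_left_mono) auto
    also have "\<dots> \<le> q - p" by (rule 2)
    finally have "(t1 * t2) * (q - p) \<le> 1 * (q - p)" by simp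
    then show False using t12 ord by (simp add: mult_le_cancel_right)
  qed
  then show ?case
  proof
    assume less: "q' - p' < t1 * (q - p)"
    have "q' < M1" using A(6)[OF gA] less ord by linarith
    then obtain a b where ab: "is_gap A a b" "q \<le> a" "a < q'" "q' < b" "b \<le> M1"
      using gap_around[OF A(1) mem(2) ord(3) A(3) _ dis'[OF mem(4)]] by blast
    have "\<rho> \<le> q' - a" using sep'[of a q'] ab mem by (auto simp: is_gap_def)
    then have "t1 * min (q - p) (b - a) \<le> (q' - p') - 2 * \<rho>"
      using A(7)[OF gA ab(1,2)] qp' by linarith
    also have "\<dots> < t1 * (q - p) - t1 * \<kappa>" using less \<kappa> \<rho> by linarith
    also have "\<dots> = t1 * (q - p - \<kappa>)" by (simp add: algebra_simps)
    finally have "min (q - p) (b - a) < q - p - \<kappa>" using t1 by (simp add: mult_less_cancel_left)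
    then have sm: "b - a < q - p - \<kappa>" using \<kappa> by linarith
    have "\<not> (q' - p') + (b - a) \<le> real n * \<kappa>"
      by (rule Suc.IH[OF Suc.prems(2,1) t2 t1 comm sep' \<rho> \<kappa>(1,3,2) gB ab(1)])
        (use ab ord in auto)
    then show ?thesis using sm by (simp add: algebra_simps)
  next
    assume less: "q - p < t2 * (q' - p')"
    have "m2 < p" using B(5)[OF gB] less ord by linarith
    then obtain a b where ab: "is_gap B a b" "m2 \<le> a" "a < p" "p < b" "b \<le> p'"
      using gap_around[OF B(1,2) _ mem(3) ord(1) dis[OF mem(1)]] by blast
    have "\<rho> \<le> b - p" using sep'[of p b] ab mem by (auto simp: is_gap_def)
    then have "t2 * min (b - a) (q' - p') \<le> (q - p) - 2 * \<rho>"
      using B(7)[OF ab(1) gB ab(5)] qp' by linarith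
    also have "\<dots> < t2 * (q' - p') - t2 * \<kappa>" using less \<kappa> \<rho> by linarith
    also have "\<dots> = t2 * (q' - p' - \<kappa>)" by (simp add: algebra_simps)
    finally have "min (b - a) (q' - p') < q' - p' - \<kappa>" using t2 by (simp add: mult_less_cancel_left)
    then have sm: "b - a < q' - p' - \<kappa>" using \<kappa> by linarith
    have "\<not> (b - a) + (q - p) \<le> real n * \<kappa>"
      by (rule Suc.IH[OF Suc.prems(2,1) t2 t1 comm sep' \<rho> \<kappa>(1,3,2) ab(1) gA])
        (use ab ord in auto)
    then show ?thesis using sm by (simp add: algebra_simps)
  qed
qed

text \<open>If the sets were disjoint, the gap of \<open>A\<close> around \<open>M2\<close> and the gap of \<open>B\<close> around its left
  endpoint would be linked, contrary to the previous lemma.\<close>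

lemma thick_sets_with_linked_hulls_meet:
  assumes A: "thick t1 m1 M1 A" and B: "thick t2 m2 M2 B" and t: "0 < t1" "0 < t2" "1 < t1 * t2"
    and hulls: "m2 < m1" "m1 < M2" "M2 < M1"
  shows "A \<inter> B \<noteq> {}"
proof
  assume disj: "A \<inter> B = {}"
  note A' = thickD[OF A] and B' = thickD[OF B]
  have "M2 \<notin> A" using disj B'(3) by auto
  then obtain p' q' where g': "is_gap A p' q'" "m1 \<le> p'" "p' < M2" "M2 < q'"
    using gap_around[OF A'(1,2) hulls(2) A'(3) hulls(3)] by blast
  then have p': "p' \<notin> B" "m2 < p'" using disj hulls by (auto simp: is_gap_def)
  obtain p q where g: "is_gap B p q" "p < p'" "p' < q" "q \<le> M2"
    using gap_around[OF B'(1,2) p'(2) B'(3) g'(3) p'(1)] by blast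
  have "0 < setdist A B"
    using setdist_gt_0_compact_closed[OF A'(1) compact_imp_closed[OF B'(1)]] A'(2) B'(2) disj
    by blast
  then obtain \<rho> where \<rho>: "0 < \<rho>" "\<rho> = setdist A B" by blast
  have sep: "\<rho> \<le> \<bar>b - a\<bar>" if "b \<in> B" "a \<in> A" for a b
    using setdist_le_dist[OF that(2,1)] \<rho> by (simp add: dist_real_def abs_minus_commute)
  define \<kappa> where "\<kappa> = min (\<rho> / t1) (\<rho> / t2)"
  have \<kappa>: "0 < \<kappa>" "t2 * \<kappa> \<le> \<rho>" "t1 * \<kappa> \<le> \<rho>"
    using \<rho> t by (auto simp: \<kappa>_def min_def field_simps)
  obtain n where "(q - p) + (q' - p') \<le> real n * \<kappa>"
    using reals_Archimedean3[OF \<kappa>(1)] less_imp_le by metis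
  moreover have "\<not> (q - p) + (q' - p') \<le> real n * \<kappa>"
    by (rule no_linked_gaps[OF B A t(2,1) _ sep \<rho>(1) \<kappa> g(1) g'(1)])
      (use g g' t in \<open>auto simp: mult.commute\<close>)
  ultimately show False by blast
qed

subsection \<open>Cutting and mapping thick sets\<close>

text \<open>A set without interior has small gaps immediately to the right of any gap \<open>(p, q)\<close>: the
  point \<open>q\<close> is not isolated from the right, as two gaps cannot have distance zero.\<close>

lemma gaps_accumulate_right:
  assumes S: "thick t m M S" and t: "0 < t" and int: "interior S = {}"
    and g: "is_gap S p q" and e: "0 < e"
  obtains r r' where "is_gap S r r'" "q < r" "r' < q + e"
proof -
  note S' = thickD[OF S]
  have pq: "p < q" "q \<in> S" using g by (auto simp: is_gap_def)
  have apart: "q < r" if "is_gap S r r'" "q \<le> r" for r r'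
  proof -
    have "0 < min (q - p) (r' - r)" using pq that by (auto simp: is_gap_def)
    then have "0 < t * min (q - p) (r' - r)" using t by simp
    then show ?thesis using S'(7)[OF g that] by linarith
  qed
  have "0 < t * (q - p)" using t pq by simp
  then have qM: "q < M" using S'(6)[OF g] by linarith
  define e' where "e' = min e (M - q)"
  have e': "0 < e'" "e' \<le> e" "q + e' \<le> M" using e qM by (auto simp: e'_def)
  obtain w where w: "w \<in> S" "q < w" "w < q + e'"
  proof (rule ccontr)
    assume no: "\<not> thesis"
    have mid: "q < q + e'/2" "q + e'/2 < M" using e' by auto
    have "q + e'/2 \<notin> S" using that[of "q + e'/2"] no e' by auto
    then obtain r r' where r: "is_gap S r r'" "q \<le> r" "r < q + e'/2"
      using gap_around[OF S'(1) pq(2) mid(1) S'(3) mid(2)] by blast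
    then have "r \<in> S" "q < r" using apart by (auto simp: is_gap_def)
    then show False using no that[of r] r e' by auto
  qed
  obtain x where x: "q < x" "x < w" "x \<notin> S"
  proof (rule ccontr)
    assume "\<not> thesis"
    then have "{q<..<w} \<subseteq> S" using that by (metis greaterThanLessThan_iff subsetI)
    then have "{q<..<w} \<subseteq> interior S" by (simp add: interior_maximal)
    moreover have "(q + w)/2 \<in> {q<..<w}" using w by auto
    ultimately show False using int by blast
  qed
  obtain r r' where "is_gap S r r'" "q \<le> r" "r' \<le> w"
    using gap_around[OF S'(1) pq(2) x(1) w(1) x(2,3)] by blast
  then show ?thesis using that[of r r'] apart w e' by auto
qed

text \<open>Between the right endpoint of a gap and the left endpoint of a later gap, both gaps larger
  than everything between them, a set keeps its thickness.  As only a nearly largest gap is chosen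
  on the right, the thickness drops by an arbitrarily small amount.\<close>

lemma thick_piece_right_of_gap:
  assumes S: "thick t m M S" and t: "0 < t'" "t' < t" and int: "interior S = {}"
    and g: "is_gap S p q" and e: "0 < e"
  obtains r where "q < r" "r < q + e" "thick t' q r (S \<inter> {q..r})"
proof -
  note S' = thickD[OF S]
  have t0: "0 < t" using t by simp
  have pq: "p < q" "q \<in> S" using g by (auto simp: is_gap_def)
  define e' where "e' = min e (q - p)"
  have e': "0 < e'" "e' \<le> e" "e' \<le> q - p" using e pq by (auto simp: e'_def)
  define L where "L = {r' - r |r r'. is_gap S r r' \<and> q < r \<and> r' < q + e'}"
  have bdd: "bdd_above L" by (rule bdd_aboveI[of _ e']) (auto simp: L_def)
  obtain l where l: "l \<in> L"
    using gaps_accumulate_right[OF S t0 int g e'(1)] by (fastforce simp: L_def)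
  have "0 < l" using l by (auto simp: L_def is_gap_def)
  then have sup: "0 < Sup L" using cSup_upper[OF l bdd] by linarith
  have "t' / t * Sup L < Sup L" using t t0 sup by (simp add: field_simps)
  then obtain l' where l': "l' \<in> L" "t' / t * Sup L < l'"
    using less_cSupE[of _ L] l by blast
  then obtain r r' where r: "is_gap S r r'" "q < r" "r' < q + e'" "l' = r' - r"
    by (auto simp: L_def)
  have rr: "r < r'" "r \<in> S" using r by (auto simp: is_gap_def)
  let ?A = "S \<inter> {q..r}"
  have sub: "is_gap S x y" "q \<le> x" "y \<le> r" if "is_gap ?A x y" for x y
    using that by (auto simp: is_gap_def)
  have big: "min (q - p) (y - x) = y - x" "t' * (y - x) \<le> t * (y - x)"
      "t' * (y - x) \<le> t * (r' - r)" if gap: "is_gap ?A x y" for x y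
  proof -
    note g' = sub[OF gap]
    have xy: "x < y" using g' by (auto simp: is_gap_def)
    have min: "min (q - p) (y - x) = y - x" using e' g' r rr by auto
    have "0 < t * min (q - p) (y - x)" using t0 pq xy by simp
    then have "q < x" using S'(7)[OF g g'(1,2)] by linarith
    then have "is_gap S x y \<and> q < x \<and> y < q + e'" using g' r rr by auto
    then have "y - x \<in> L" unfolding L_def by blast
    then have "y - x \<le> Sup L" using bdd by (rule cSup_upper)
    then have "t' * (y - x) \<le> t' * Sup L" using t by simp
    also have "\<dots> \<le> t * (r' - r)" using l'(2) r(4) t0 by (simp add: field_simps)
    finally show "t' * (y - x) \<le> t * (r' - r)" .
    show "t' * (y - x) \<le> t * (y - x)" using t xy by (intro mult_right_mono) auto
    show "min (q - p) (y - x) = y - x" by (rule min)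
  qed
  have "thick t' q r ?A"
    unfolding thick_def
  proof (intro conjI allI impI)
    show "compact ?A" using S' by (auto intro: compact_Int_closed)
    show "q \<in> ?A" "r \<in> ?A" "?A \<subseteq> {q..r}" using pq rr r by auto
  next
    fix x y assume gap: "is_gap ?A x y"
    note b = big[OF gap] and g' = sub[OF gap]
    show "t' * (y - x) \<le> x - q" using S'(7)[OF g g'(1,2)] b by auto
    show "t' * (y - x) \<le> r - y" using S'(7)[OF g'(1) r(1) g'(3)] b by (auto simp: min_def split: if_splits)
  next
    fix x y x' y' assume gap: "is_gap ?A x y" "is_gap ?A x' y'" "y \<le> x'"
    have "0 < min (y - x) (y' - x')" using gap by (auto simp: is_gap_def)
    then have "t' * min (y - x) (y' - x') \<le> t * min (y - x) (y' - x')"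
      using t by (intro mult_right_mono) auto
    also have "\<dots> \<le> x' - y" by (rule S'(7)[OF sub(1)[OF gap(1)] sub(1)[OF gap(2)] gap(3)])
    finally show "t' * min (y - x) (y' - x') \<le> x' - y" .
  qed
  then show ?thesis using that[of r] r rr e' by auto
qed

text \<open>A map that distorts lengths by factors between \<open>c\<close> and \<open>d\<close> changes the ratio of two lengths
  by a factor of at least \<open>c / d\<close>.\<close>

lemma thick_image:
  assumes S: "thick t m M S" and t: "0 < t" and cd: "0 < c" "c \<le> d"
    and f: "continuous_on S f"
    and lower: "\<And>x y. m \<le> x \<Longrightarrow> x \<le> y \<Longrightarrow> y \<le> M \<Longrightarrow> c * (y - x) \<le> f y - f x"
    and upper: "\<And>x y. m \<le> x \<Longrightarrow> x \<le> y \<Longrightarrow> y \<le> M \<Longrightarrow> f y - f x \<le> d * (y - x)"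
  shows "thick (t * (c / d)) (f m) (f M) (f ` S)"
proof -
  note S' = thickD[OF S]
  have d: "0 < d" using cd by simp
  have mono: "f x < f y" if "x \<in> S" "y \<in> S" "x < y" for x y
  proof -
    have "0 < c * (y - x)" using cd that by simp
    also have "\<dots> \<le> f y - f x" using lower S'(4) that by auto
    finally show ?thesis by simp
  qed
  have mono_le: "x \<le> y" if "x \<in> S" "y \<in> S" "f x \<le> f y" for x y
    using mono[OF that(2,1)] that(3) by (meson leD not_le)
  have mono': "f x \<le> f y" if "x \<in> S" "y \<in> S" "x \<le> y" for x y
    using mono[OF that(1,2)] that(3) by (cases "x = y") auto
  have gap: "\<exists>p q. P = f p \<and> Q = f q \<and> is_gap S p q" if "is_gap (f ` S) P Q" for P Q
  proof -
    have "P \<in> f ` S" "Q \<in> f ` S" using that by (auto simp: is_gap_def)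
    then obtain p q where pq: "P = f p" "Q = f q" "p \<in> S" "q \<in> S" by blast
    have "f p < f q" using that pq by (simp add: is_gap_def)
    then have "p < q" using mono_le[OF pq(3,4)] by (cases "p = q") auto
    moreover have False if x: "x \<in> S" "p < x" "x < q" for x
    proof -
      have "f x \<in> {P<..<Q} \<inter> f ` S" using mono x pq by auto
      then show False using \<open>is_gap (f ` S) P Q\<close> by (auto simp: is_gap_def)
    qed
    ultimately have "is_gap S p q" using pq by (auto simp: is_gap_def)
    then show ?thesis using pq by blast
  qed
  have scale: "t * (c / d) * (f q - f p) \<le> c * (t * (q - p))" if "is_gap S p q" for p q
  proof -
    have "f q - f p \<le> d * (q - p)" using upper S'(4) that by (auto simp: is_gap_def)
    then have "t * (c / d) * (f q - f p) \<le> t * (c / d) * (d * (q - p))"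
      using t cd d by (intro mult_left_mono) auto
    then show ?thesis using d by (simp add: algebra_simps)
  qed
  have stretch: "l \<le> f y - f x" if "l \<le> c * v" "v \<le> y - x" "x \<in> S" "y \<in> S" "x \<le> y" for l v x y
  proof -
    have "c * v \<le> c * (y - x)" using that cd by simp
    then show ?thesis using that lower[of x y] S'(4) by fastforce
  qed
  show ?thesis
    unfolding thick_def
  proof (intro conjI allI impI)
    show "compact (f ` S)" using f S' by (simp add: compact_continuous_image)
    show "f m \<in> f ` S" "f M \<in> f ` S" using S' by auto
    show "f ` S \<subseteq> {f m..f M}" using mono' S'(2-4) by auto
  next
    fix P Q assume "is_gap (f ` S) P Q"
    then obtain p q where pq: "P = f p" "Q = f q" "is_gap S p q" using gap by blast
    then have mem: "p \<in> S" "q \<in> S" by (auto simp: is_gap_def)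
    show "t * (c / d) * (Q - P) \<le> P - f m" "t * (c / d) * (Q - P) \<le> f M - Q"
      unfolding pq
      using stretch[OF scale[OF pq(3)] S'(5)[OF pq(3)]] stretch[OF scale[OF pq(3)] S'(6)[OF pq(3)]]
        S' mem by auto
  next
    fix P Q P' Q' assume gaps: "is_gap (f ` S) P Q" "is_gap (f ` S) P' Q'" "Q \<le> P'"
    obtain p q where pq: "P = f p" "Q = f q" "is_gap S p q" using gap gaps by blast
    obtain p' q' where pq': "P' = f p'" "Q' = f q'" "is_gap S p' q'" using gap gaps by blast
    have mem: "q \<in> S" "p' \<in> S" using pq pq' by (auto simp: is_gap_def)
    have le: "q \<le> p'" using mono_le mem gaps(3) pq pq' by blast
    have "t * (c / d) * min (Q - P) (Q' - P') \<le> c * (t * min (q - p) (q' - p'))"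
    proof (cases "q - p \<le> q' - p'")
      case True
      have "t * (c / d) * min (Q - P) (Q' - P') \<le> t * (c / d) * (Q - P)"
        using t cd d by (intro mult_left_mono) auto
      then show ?thesis using scale[OF pq(3)] True pq by auto
    next
      case False
      have "t * (c / d) * min (Q - P) (Q' - P') \<le> t * (c / d) * (Q' - P')"
        using t cd d by (intro mult_left_mono) auto
      then show ?thesis using scale[OF pq'(3)] False pq' by auto
    qed
    then show "t * (c / d) * min (Q - P) (Q' - P') \<le> P' - Q"
      using stretch[OF _ S'(7)[OF pq(3) pq'(3) le] mem le] pq pq' by auto
  qed
qed

lemma thick_reflect:
  assumes S: "thick t m M S"
  shows "thick t (s - M) (s - m) ((\<lambda>x. s - x) ` S)"
proof -
  note S' = thickD[OF S]
  have mem: "x \<in> (\<lambda>x. s - x) ` S \<longleftrightarrow> s - x \<in> S" for x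
  proof
    assume "s - x \<in> S"
    then have "s - (s - x) \<in> (\<lambda>x. s - x) ` S" by (rule imageI)
    then show "x \<in> (\<lambda>x. s - x) ` S" by simp
  qed auto
  have gap: "is_gap S (s - q) (s - p)" if g: "is_gap ((\<lambda>x. s - x) ` S) p q" for p q
  proof -
    have "x \<notin> {s - q<..<s - p} \<inter> S" for x
    proof
      assume "x \<in> {s - q<..<s - p} \<inter> S"
      then have "s - x \<in> {p<..<q} \<inter> (\<lambda>x. s - x) ` S" by auto
      then show False using g unfolding is_gap_def by blast
    qed
    then have "{s - q<..<s - p} \<inter> S = {}" by blast
    moreover have "p < q" "s - p \<in> S" "s - q \<in> S" using g by (auto simp: is_gap_def mem simp del: image_iff)
    ultimately show ?thesis by (simp add: is_gap_def)
  qed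
  show ?thesis
    unfolding thick_def
  proof (intro conjI allI impI)
    show "compact ((\<lambda>x. s - x) ` S)"
      using S' by (intro compact_continuous_image continuous_intros)
    show "s - M \<in> (\<lambda>x. s - x) ` S" "s - m \<in> (\<lambda>x. s - x) ` S" using S' by auto
    show "(\<lambda>x. s - x) ` S \<subseteq> {s - M..s - m}" using S' by auto
  next
    fix p q assume g: "is_gap ((\<lambda>x. s - x) ` S) p q"
    show "t * (q - p) \<le> p - (s - M)" "t * (q - p) \<le> s - m - q"
      using S'(5,6)[OF gap[OF g]] by (auto simp: algebra_simps)
  next
    fix p q p' q' assume g: "is_gap ((\<lambda>x. s - x) ` S) p q" "is_gap ((\<lambda>x. s - x) ` S) p' q'" "q \<le> p'"
    show "t * min (q - p) (q' - p') \<le> p' - q"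
      using S'(7)[OF gap[OF g(2)] gap[OF g(1)]] g(3) by (simp add: min.commute)
  qed
qed

subsection \<open>Sums of two squares over thick sets\<close>

text \<open>A solution exists if the images of the two sets under \<open>u \<mapsto> (u - a)\<^sup>2\<close> and
  \<open>v \<mapsto> s - (v - b)\<^sup>2\<close> meet.  For each map, the smallest slope over the set is at least \<open>\<kappa>\<close> times
  the largest one, and the inequalities for \<open>s\<close> say that the hulls of the images are linked.\<close>

lemma sum_of_squares_over_thick_sets:
  assumes A: "thick t1 q1 r1 A" and B: "thick t2 q2 r2 B" and t: "0 < t1" "0 < t2"
    and \<kappa>: "0 < \<kappa>" "1 < (t1 * \<kappa>) * (t2 * \<kappa>)"
    and a: "a < q1" "\<kappa> * (r1 - a) \<le> q1 - a" and b: "b < q2" "\<kappa> * (r2 - b) \<le> q2 - b"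
    and s: "(q1 - a)\<^sup>2 + (q2 - b)\<^sup>2 < s" "s < (r1 - a)\<^sup>2 + (q2 - b)\<^sup>2" "s < (q1 - a)\<^sup>2 + (r2 - b)\<^sup>2"
  shows "\<exists>u\<in>A. \<exists>v\<in>B. (u - a)\<^sup>2 + (v - b)\<^sup>2 = s"
proof -
  have square: "thick (t * ((2 * (q - c)) / (2 * (r - c)))) ((q - c)\<^sup>2) ((r - c)\<^sup>2) ((\<lambda>u. (u - c)\<^sup>2) ` S)"
    and ratio: "\<kappa> \<le> (2 * (q - c)) / (2 * (r - c))"
    if S: "thick t q r S" "0 < t" and c: "c < q" "\<kappa> * (r - c) \<le> q - c" for t q r c S
  proof -
    have qr: "q \<le> r" using thickD(2,4)[OF S(1)] by blast
    have diff: "(y - c)\<^sup>2 - (x - c)\<^sup>2 = ((x - c) + (y - c)) * (y - x)" for x y :: real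
      by (simp add: power2_eq_square algebra_simps)
    show "\<kappa> \<le> (2 * (q - c)) / (2 * (r - c))" using c qr by (simp add: field_simps)
    show "thick (t * ((2 * (q - c)) / (2 * (r - c)))) ((q - c)\<^sup>2) ((r - c)\<^sup>2) ((\<lambda>u. (u - c)\<^sup>2) ` S)"
    proof (rule thick_image[OF S])
      show "0 < 2 * (q - c)" "2 * (q - c) \<le> 2 * (r - c)" using c qr by auto
      show "continuous_on S (\<lambda>u. (u - c)\<^sup>2)" by (intro continuous_intros)
      fix x y assume "q \<le> x" "x \<le> y" "y \<le> r"
      then show "2 * (q - c) * (y - x) \<le> (y - c)\<^sup>2 - (x - c)\<^sup>2"
          "(y - c)\<^sup>2 - (x - c)\<^sup>2 \<le> 2 * (r - c) * (y - x)"
        unfolding diff by (auto intro!: mult_right_mono)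
    qed
  qed
  let ?k1 = "(2 * (q1 - a)) / (2 * (r1 - a))" let ?k2 = "(2 * (q2 - b)) / (2 * (r2 - b))"
  have k: "\<kappa> \<le> ?k1" "\<kappa> \<le> ?k2" using ratio[OF A t(1) a] ratio[OF B t(2) b] by auto
  have "(t1 * \<kappa>) * (t2 * \<kappa>) \<le> (t1 * ?k1) * (t2 * ?k2)"
    using t \<kappa>(1) k by (intro mult_mono mult_left_mono mult_nonneg_nonneg) auto
  then have big: "1 < (t1 * ?k1) * (t2 * ?k2)" using \<kappa>(2) by linarith
  have "0 < ?k1" "0 < ?k2" using k \<kappa>(1) by linarith+
  then have pos: "0 < t1 * ?k1" "0 < t2 * ?k2" using t by (blast intro: mult_pos_pos)+
  have "(\<lambda>u. (u - a)\<^sup>2) ` A \<inter> (\<lambda>x. s - x) ` (\<lambda>v. (v - b)\<^sup>2) ` B \<noteq> {}"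
    by (rule thick_sets_with_linked_hulls_meet
        [OF square[OF A t(1) a] thick_reflect[OF square[OF B t(2) b]] pos big])
      (use s in auto)
  then show ?thesis by force
qed

text \<open>Near the right endpoints of two gaps the squares are almost linear, and there are pieces of
  almost full thickness to which the previous lemma applies, uniformly in the centre.\<close>

lemma sum_of_squares_near_gap_endpoints:
  assumes S1: "thick t1 m1 M1 S1" "interior S1 = {}" "is_gap S1 p1 q1" "a < q1"
    and S2: "thick t2 m2 M2 S2" "interior S2 = {}" "is_gap S2 p2 q2" "b < q2"
    and t: "0 < t1" "0 < t2" "1 < t1 * t2" and \<epsilon>: "0 < \<epsilon>"
  obtains s where "\<forall>\<^sub>F z in nhds ((a, b), s). 0 < snd z \<and>
    (\<exists>u\<in>S1. \<exists>v\<in>S2. \<bar>u - q1\<bar> < \<epsilon> \<and> \<bar>v - q2\<bar> < \<epsilon> \<and>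
       (u - fst (fst z))\<^sup>2 + (v - snd (fst z))\<^sup>2 = (snd z)\<^sup>2)"
proof -
  (* each thickness loses a factor \<kappa> by cutting and another one by squaring *)
  have "((\<lambda>\<kappa>. t1 * \<kappa> * \<kappa> * (t2 * \<kappa> * \<kappa>)) \<longlongrightarrow> t1 * 1 * 1 * (t2 * 1 * 1)) (at_left 1)"
    by (intro tendsto_intros)
  then have "\<forall>\<^sub>F \<kappa> in at_left 1. 1 < t1 * \<kappa> * \<kappa> * (t2 * \<kappa> * \<kappa>)"
    by (rule order_tendstoD) (use t in simp)
  moreover have "\<forall>\<^sub>F \<kappa> in at_left 1. (0::real) < \<kappa> \<and> \<kappa> < 1"
    using eventually_at_left_real[of 0 "1::real"] by simp
  ultimately have "\<forall>\<^sub>F \<kappa> in at_left 1. 1 < t1 * \<kappa> * \<kappa> * (t2 * \<kappa> * \<kappa>) \<and> 0 < \<kappa> \<and> \<kappa> < 1"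
    by (rule eventually_conj)
  then obtain \<kappa> where \<kappa>: "1 < t1 * \<kappa> * \<kappa> * (t2 * \<kappa> * \<kappa>)" "0 < \<kappa>" "\<kappa> < 1"
    by (metis (no_types, lifting) eventually_happens trivial_limit_at_left_real)
  define e where "e = min \<epsilon> (min (q1 - a) (q2 - b) * (1 - \<kappa>) / 2)"
  have e: "0 < e" "e \<le> \<epsilon>" and e1: "2 * e \<le> (q1 - a) * (1 - \<kappa>)" and e2: "2 * e \<le> (q2 - b) * (1 - \<kappa>)"
  proof -
    have "0 < min (q1 - a) (q2 - b) * (1 - \<kappa>)" using S1(4) S2(4) \<kappa> by simp
    then show "0 < e" "e \<le> \<epsilon>" using \<epsilon> by (auto simp: e_def)
    have "min (q1 - a) (q2 - b) * (1 - \<kappa>) \<le> (q1 - a) * (1 - \<kappa>)"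
         "min (q1 - a) (q2 - b) * (1 - \<kappa>) \<le> (q2 - b) * (1 - \<kappa>)"
      using \<kappa> by (auto intro!: mult_right_mono)
    then show "2 * e \<le> (q1 - a) * (1 - \<kappa>)" "2 * e \<le> (q2 - b) * (1 - \<kappa>)"
      by (auto simp: e_def)
  qed
  have t': "0 < t1 * \<kappa>" "t1 * \<kappa> < t1" "0 < t2 * \<kappa>" "t2 * \<kappa> < t2" using t \<kappa> by auto
  obtain r1 where r1: "q1 < r1" "r1 < q1 + e" "thick (t1 * \<kappa>) q1 r1 (S1 \<inter> {q1..r1})"
    by (rule thick_piece_right_of_gap[OF S1(1) t'(1,2) S1(2,3) e(1)])
  obtain r2 where r2: "q2 < r2" "r2 < q2 + e" "thick (t2 * \<kappa>) q2 r2 (S2 \<inter> {q2..r2})"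
    by (rule thick_piece_right_of_gap[OF S2(1) t'(3,4) S2(2,3) e(1)])
  (* e is so small that moving the centre by less than e and making the piece shorter than e
     keeps the ratio of the slopes at the two ends of the piece above \<kappa> *)
  have centre: "y < q" "\<kappa> * (r - y) \<le> q - y"
    if h: "2 * e \<le> (q - c) * (1 - \<kappa>)" "c < q" "r < q + e" "\<bar>y - c\<bar> < e" for y q r c
  proof -
    have "(q - c) * (1 - \<kappa>) \<le> (q - c) * 1" using h \<kappa> by (intro mult_left_mono) auto
    then have "2 * e \<le> q - c" using h(1) by simp
    moreover have "y - c < e" using h(4) by linarith
    ultimately have yq: "e < q - y" by linarith
    then show "y < q" using e by linarith
    have "(q - c) * (1 - \<kappa>) \<le> (q - y + e) * (1 - \<kappa>)" using h \<kappa> by (intro mult_right_mono) auto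
    moreover have "e * (1 - \<kappa>) \<le> e * 1" using e \<kappa> by (intro mult_left_mono) auto
    ultimately have "e \<le> (q - y) * (1 - \<kappa>)" using h by (simp add: algebra_simps)
    moreover have "\<kappa> * (r - y) \<le> \<kappa> * (q - y + e)" using h \<kappa> by (intro mult_left_mono) auto
    moreover have "\<kappa> * e \<le> e" using e \<kappa> by simp
    ultimately show "\<kappa> * (r - y) \<le> q - y" by (simp add: algebra_simps)
  qed
  define \<mu> where "\<mu> = min ((r1 - a)\<^sup>2 - (q1 - a)\<^sup>2) ((r2 - b)\<^sup>2 - (q2 - b)\<^sup>2)"
  have "(q1 - a)\<^sup>2 < (r1 - a)\<^sup>2" "(q2 - b)\<^sup>2 < (r2 - b)\<^sup>2"
    using r1 r2 S1(4) S2(4) by (auto intro!: power_strict_mono)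
  then have \<mu>: "0 < \<mu>" by (simp add: \<mu>_def)
  have "\<mu> \<le> (r1 - a)\<^sup>2 - (q1 - a)\<^sup>2" "\<mu> \<le> (r2 - b)\<^sup>2 - (q2 - b)\<^sup>2" by (auto simp: \<mu>_def)
  then have \<mu>_le: "(q1 - a)\<^sup>2 + \<mu> / 2 < (r1 - a)\<^sup>2" "(q2 - b)\<^sup>2 + \<mu> / 2 < (r2 - b)\<^sup>2"
    using \<mu> by linarith+
  define s where "s = sqrt ((q1 - a)\<^sup>2 + (q2 - b)\<^sup>2 + \<mu> / 2)"
  have s_pos: "0 < s" using \<mu> by (simp add: s_def add_nonneg_pos)
  have s2: "s\<^sup>2 = (q1 - a)\<^sup>2 + (q2 - b)\<^sup>2 + \<mu> / 2" using \<mu> by (simp add: s_def)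
  define W where "W = {z :: (real \<times> real) \<times> real. 0 < snd z \<and> \<bar>fst (fst z) - a\<bar> < e \<and> \<bar>snd (fst z) - b\<bar> < e \<and>
      (q1 - fst (fst z))\<^sup>2 + (q2 - snd (fst z))\<^sup>2 < (snd z)\<^sup>2 \<and>
      (snd z)\<^sup>2 < (r1 - fst (fst z))\<^sup>2 + (q2 - snd (fst z))\<^sup>2 \<and>
      (snd z)\<^sup>2 < (q1 - fst (fst z))\<^sup>2 + (r2 - snd (fst z))\<^sup>2}"
  have "open W"
    unfolding W_def by (intro open_Collect_conj open_Collect_less continuous_intros)
  moreover have "((a, b), s) \<in> W"
    using s_pos s2 \<mu> e \<mu>_le by (simp add: W_def)
  ultimately have "\<forall>\<^sub>F z in nhds ((a, b), s). z \<in> W" by (rule eventually_nhds_in_open)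
  then have "\<forall>\<^sub>F z in nhds ((a, b), s). 0 < snd z \<and>
    (\<exists>u\<in>S1. \<exists>v\<in>S2. \<bar>u - q1\<bar> < \<epsilon> \<and> \<bar>v - q2\<bar> < \<epsilon> \<and>
       (u - fst (fst z))\<^sup>2 + (v - snd (fst z))\<^sup>2 = (snd z)\<^sup>2)"
  proof (rule eventually_mono)
    fix z assume z: "z \<in> W"
    have "\<exists>u\<in>S1 \<inter> {q1..r1}. \<exists>v\<in>S2 \<inter> {q2..r2}. (u - fst (fst z))\<^sup>2 + (v - snd (fst z))\<^sup>2 = (snd z)\<^sup>2"
      by (rule sum_of_squares_over_thick_sets[OF r1(3) r2(3) t'(1,3) \<kappa>(2,1)])
        (use z centre[OF e1 S1(4) r1(2)] centre[OF e2 S2(4) r2(2)] in \<open>auto simp: W_def\<close>)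
    then obtain u v where "u \<in> S1 \<inter> {q1..r1}" "v \<in> S2 \<inter> {q2..r2}"
        "(u - fst (fst z))\<^sup>2 + (v - snd (fst z))\<^sup>2 = (snd z)\<^sup>2"
      by blast
    then show "0 < snd z \<and> (\<exists>u\<in>S1. \<exists>v\<in>S2. \<bar>u - q1\<bar> < \<epsilon> \<and> \<bar>v - q2\<bar> < \<epsilon> \<and>
       (u - fst (fst z))\<^sup>2 + (v - snd (fst z))\<^sup>2 = (snd z)\<^sup>2)"
      using z r1(2) r2(2) e by (intro conjI bexI[of _ u] bexI[of _ v]) (auto simp: W_def)
  qed
  then show ?thesis by (rule that)
qed

section \<open>Realizing trees\<close>

text \<open>The distance \<open>s\<close> and all distances near it are realized not only from \<open>y\<close> but from all
  points near \<open>y\<close>.  This is what lets a construction proceed along a tree, where the position of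
  a vertex moves with the distances prescribed on the edges before it.\<close>

definition robustly_reaches :: "'b::real_normed_vector set \<Rightarrow> 'b \<Rightarrow> 'b \<Rightarrow> bool" where
  "robustly_reaches B y z \<longleftrightarrow>
     (\<forall>\<epsilon>>0. \<exists>s. \<forall>\<^sub>F (y', s') in nhds (y, s). \<exists>z'\<in>B. dist z z' < \<epsilon> \<and> dist y' z' = s')"

text \<open>Avoiding a finite set allows distinct vertices to be placed at distinct points.\<close>

definition robustly_leaves :: "'b::real_normed_vector set \<Rightarrow> bool" where
  "robustly_leaves B \<longleftrightarrow> (\<forall>y\<in>B. \<forall>F. finite F \<longrightarrow> (\<exists>z\<in>B - F. robustly_reaches B y z))"

definition path_linked :: "('v \<Rightarrow> 'v \<Rightarrow> bool) \<Rightarrow> 'v set \<Rightarrow> bool" where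
  "path_linked adj W \<longleftrightarrow> (\<forall>u\<in>W. \<forall>v\<in>W. \<exists>p. p \<noteq> [] \<and> distinct p \<and> set p \<subseteq> W \<and>
     hd p = u \<and> last p = v \<and> successively adj p)"

lemma path_linkedE:
  assumes "path_linked adj W" "u \<in> W" "v \<in> W"
  obtains p where "p \<noteq> []" "distinct p" "set p \<subseteq> W" "hd p = u" "last p = v" "successively adj p"
proof -
  have "\<exists>p. p \<noteq> [] \<and> distinct p \<and> set p \<subseteq> W \<and> hd p = u \<and> last p = v \<and> successively adj p"
    using assms by (simp add: path_linked_def)
  then show ?thesis using that by auto
qed

lemma path_linked_insert:
  assumes W: "path_linked adj W" and l: "l \<notin> W" "w \<in> W" "adj w l"
    and sym: "\<And>i j. adj i j \<Longrightarrow> adj j i"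
  shows "path_linked adj (insert l W)"
proof -
  have to_l: "\<exists>p. p \<noteq> [] \<and> distinct p \<and> set p \<subseteq> insert l W \<and> hd p = u \<and> last p = l \<and> successively adj p"
    if u: "u \<in> W" for u
  proof -
    obtain p where "p \<noteq> []" "distinct p" "set p \<subseteq> W" "hd p = u" "last p = w" "successively adj p"
      by (rule path_linkedE[OF W u l(2)])
    then show ?thesis
      using l by (intro exI[of _ "p @ [l]"]) (auto simp: successively_append_iff)
  qed
  have from_l: "\<exists>p. p \<noteq> [] \<and> distinct p \<and> set p \<subseteq> insert l W \<and> hd p = l \<and> last p = u \<and> successively adj p"
    if u: "u \<in> W" for u
  proof -
    obtain p where p: "p \<noteq> []" "distinct p" "set p \<subseteq> insert l W" "hd p = u" "last p = l"
      "successively adj p"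
      using to_l[OF u] by blast
    have "successively adj (rev p)"
      unfolding successively_rev by (rule successively_mono[OF p(6)]) (rule sym)
    then show ?thesis
      using p by (intro exI[of _ "rev p"]) (auto simp: hd_rev last_rev)
  qed
  have "\<exists>p. p \<noteq> [] \<and> distinct p \<and> set p \<subseteq> insert l W \<and> hd p = u \<and> last p = v \<and> successively adj p"
    if uv: "u \<in> insert l W" "v \<in> insert l W" for u v
  proof -
    consider "u = l" "v = l" | "u = l" "v \<in> W" | "u \<in> W" "v = l" | "u \<in> W" "v \<in> W"
      using uv by blast
    then show ?thesis
    proof cases
      case 1
      then show ?thesis by (intro exI[of _ "[l]"]) auto
    next
      case 2
      then show ?thesis using from_l[of v] by simp
    next
      case 3
      then show ?thesis using to_l[of u] by simp
    next
      case 4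
      obtain p where "p \<noteq> []" "distinct p" "set p \<subseteq> W" "hd p = u" "last p = v" "successively adj p"
        by (rule path_linkedE[OF W 4])
      then show ?thesis by (intro exI[of _ p]) auto
    qed
  qed
  then show ?thesis unfolding path_linked_def by blast
qed

text \<open>Two neighbours in a connected set close a cycle.\<close>

lemma unique_neighbour:
  assumes W: "path_linked adj W" and l: "l \<notin> W" and acyclic: "\<nexists>p. graph_cycle adj p"
    and sym: "\<And>i j. adj i j \<Longrightarrow> adj j i"
    and w: "w \<in> W" "adj w l" and v: "v \<in> W" "adj v l"
  shows "v = w"
proof (rule ccontr)
  assume ne: "v \<noteq> w"
  obtain p where p: "p \<noteq> []" "distinct p" "set p \<subseteq> W" "hd p = v" "last p = w" "successively adj p"
    by (rule path_linkedE[OF W v(1) w(1)])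
  have len: "2 \<le> length p"
  proof (rule ccontr)
    assume "\<not> 2 \<le> length p"
    moreover obtain a q where q: "p = a # q" using p(1) by (cases p) auto
    ultimately have "q = []" by (cases q) auto
    then show False using q p(4,5) ne by simp
  qed
  have succ: "successively adj (l # p)"
    using p sym[OF v(2)] by (simp add: successively_Cons)
  have "graph_cycle adj (l # p)"
    unfolding graph_cycle_def
  proof (intro conjI allI impI)
    show "3 \<le> length (l # p)" "distinct (l # p)" using len p l by auto
    fix i assume i: "i < length (l # p)"
    show "adj ((l # p) ! i) ((l # p) ! (Suc i mod length (l # p)))"
    proof (cases "i = length p")
      case True
      then have "(l # p) ! i = last (l # p)" by (simp add: last_conv_nth p(1))
      then show ?thesis using True p w by simp
    next
      case False
      then have "Suc i < length (l # p)" using i by simp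
      then show ?thesis using successively_nth[OF succ, of i] by simp
    qed
  qed
  then show False using acyclic by blast
qed

text \<open>Distances are prescribed on unordered pairs, so that an edge carries a single number.\<close>

definition realizable_near :: "'b::real_normed_vector set \<Rightarrow> 'b \<Rightarrow> ('v \<Rightarrow> 'v \<Rightarrow> bool) \<Rightarrow> 'v set \<Rightarrow> 'v \<Rightarrow>
    ('v \<Rightarrow> 'b) \<Rightarrow> real \<Rightarrow> ('v set \<Rightarrow> real) \<Rightarrow> bool" where
  "realizable_near B x adj W r p \<epsilon> s \<longleftrightarrow>
     (\<exists>X. X ` W \<subseteq> B \<and> X r = x \<and> (\<forall>v\<in>W. dist (p v) (X v) < \<epsilon>) \<and>
          (\<forall>v\<in>W. \<forall>w\<in>W. adj v w \<longrightarrow> dist (X v) (X w) = s {v, w}))"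

text \<open>The positions \<open>p\<close> do not depend on \<open>\<epsilon>\<close>; the reference distances \<open>s\<close> do.  So the positions are
  chosen from the root outwards and the tolerances from the outermost vertices inwards.\<close>

definition robustly_realized :: "'b::real_normed_vector set \<Rightarrow> 'b \<Rightarrow> ('v \<Rightarrow> 'v \<Rightarrow> bool) \<Rightarrow> 'v set \<Rightarrow> bool" where
  "robustly_realized B x adj W \<longleftrightarrow>
     (\<exists>r\<in>W. \<exists>p. p ` W \<subseteq> B \<and> inj_on p W \<and>
       (\<forall>\<epsilon>>0. \<exists>s. \<exists>\<delta>>0. \<forall>s'. (\<forall>v\<in>W. \<forall>w\<in>W. adj v w \<longrightarrow> \<bar>s' {v, w} - s {v, w}\<bar> < \<delta>) \<longrightarrow>
          realizable_near B x adj W r p \<epsilon> s'))"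

lemma robustly_realizedE:
  assumes "robustly_realized B x adj W"
  obtains r p where "r \<in> W" "p ` W \<subseteq> B" "inj_on p W"
    "\<forall>\<epsilon>>0. \<exists>s. \<exists>\<delta>>0. \<forall>s'. (\<forall>v\<in>W. \<forall>w\<in>W. adj v w \<longrightarrow> \<bar>s' {v, w} - s {v, w}\<bar> < \<delta>) \<longrightarrow>
       realizable_near B x adj W r p \<epsilon> s'"
  using assms unfolding robustly_realized_def by (elim bexE exE conjE) (rule that)

lemma robustly_realized_insert:
  fixes B :: "'b::real_normed_vector set" and W :: "'v set"
  assumes W: "robustly_realized B x adj W" and fin: "finite W"
    and leaves: "robustly_leaves B"
    and l: "l \<notin> W" "w \<in> W" and irr: "\<not> adj l l"
    and sym: "\<And>i j. adj i j \<Longrightarrow> adj j i"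
    and uniq: "\<And>v. v \<in> W \<Longrightarrow> adj v l \<Longrightarrow> v = w"
  shows "robustly_realized B x adj (insert l W)"
proof -
  obtain r p where r: "r \<in> W" and p: "p ` W \<subseteq> B" "inj_on p W"
    and ex: "\<forall>\<epsilon>>0. \<exists>s. \<exists>\<delta>>0. \<forall>s'. (\<forall>v\<in>W. \<forall>w\<in>W. adj v w \<longrightarrow> \<bar>s' {v, w} - s {v, w}\<bar> < \<delta>) \<longrightarrow>
       realizable_near B x adj W r p \<epsilon> s'"
    by (rule robustly_realizedE[OF W])
  have "p w \<in> B" using p l by auto
  then obtain z where z: "z \<in> B" "z \<notin> p ` W" "robustly_reaches B (p w) z"
    using leaves fin unfolding robustly_leaves_def by blast
  let ?p = "p(l := z)"
  have p': "?p ` insert l W \<subseteq> B" "inj_on ?p (insert l W)"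
    using p z l by (auto simp: inj_on_def)
  have main: "\<exists>s. \<exists>\<delta>>0. \<forall>s'. (\<forall>v\<in>insert l W. \<forall>w\<in>insert l W. adj v w \<longrightarrow> \<bar>s' {v, w} - s {v, w}\<bar> < \<delta>) \<longrightarrow>
          realizable_near B x adj (insert l W) r ?p \<epsilon> s'"
    if \<epsilon>: "\<epsilon> > 0" for \<epsilon> :: real
  proof -
    obtain s0 where "\<forall>\<^sub>F (y', s') in nhds (p w, s0). \<exists>z'\<in>B. dist z z' < \<epsilon> \<and> dist y' z' = s'"
      using z(3) \<epsilon> unfolding robustly_reaches_def by blast
    then obtain P Q where P: "eventually P (nhds (p w))" and Q: "eventually Q (nhds s0)"
      and PQ: "\<And>y' s'. P y' \<Longrightarrow> Q s' \<Longrightarrow> \<exists>z'\<in>B. dist z z' < \<epsilon> \<and> dist y' z' = s'"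
      unfolding nhds_prod eventually_prod_filter by auto
    obtain d where d: "0 < d" "\<And>y'. dist y' (p w) < d \<Longrightarrow> P y'"
      using P unfolding eventually_nhds_metric by blast
    obtain e where e: "0 < e" "\<And>s'. dist s' s0 < e \<Longrightarrow> Q s'"
      using Q unfolding eventually_nhds_metric by blast
    have "0 < min \<epsilon> d" using \<epsilon> d by simp
    then obtain s \<delta> where \<delta>: "0 < \<delta>" and s: "\<And>s'. (\<forall>v\<in>W. \<forall>w\<in>W. adj v w \<longrightarrow> \<bar>s' {v, w} - s {v, w}\<bar> < \<delta>) \<Longrightarrow>
          realizable_near B x adj W r p (min \<epsilon> d) s'"
      using ex[rule_format, OF \<open>0 < min \<epsilon> d\<close>] by blast
    show ?thesis
    proof (intro exI conjI allI impI)
      show "0 < min \<delta> e" using \<delta> e by simp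
      fix s' :: "'v set \<Rightarrow> real"
      assume s': "\<forall>v\<in>insert l W. \<forall>u\<in>insert l W. adj v u \<longrightarrow> \<bar>s' {v, u} - (s({w, l} := s0)) {v, u}\<bar> < min \<delta> e"
      have "\<bar>s' {v, u} - s {v, u}\<bar> < \<delta>" if "v \<in> W" "u \<in> W" "adj v u" for u v
      proof -
        have "{v, u} \<noteq> {w, l}" using that l by (auto simp: doubleton_eq_iff)
        moreover have "\<bar>s' {v, u} - (s({w, l} := s0)) {v, u}\<bar> < min \<delta> e" using s' that by blast
        ultimately show ?thesis by simp
      qed
      then obtain X where X: "X ` W \<subseteq> B" "X r = x" "\<And>v. v \<in> W \<Longrightarrow> dist (p v) (X v) < min \<epsilon> d"
          "\<And>v u. v \<in> W \<Longrightarrow> u \<in> W \<Longrightarrow> adj v u \<Longrightarrow> dist (X v) (X u) = s' {v, u}"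
        using s[of s'] unfolding realizable_near_def by blast
      have "\<exists>z'\<in>B. dist z z' < \<epsilon> \<and> (adj w l \<longrightarrow> dist (X w) z' = s' {w, l})"
      proof (cases "adj w l")
        case True
        then have "\<bar>s' {w, l} - (s({w, l} := s0)) {w, l}\<bar> < min \<delta> e" using s' l by blast
        then have "Q (s' {w, l})" by (intro e) (simp add: dist_real_def)
        moreover have "P (X w)" using X(3)[OF l(2)] by (intro d) (simp add: dist_commute)
        ultimately show ?thesis using PQ by blast
      next
        case False
        then show ?thesis using z(1) \<epsilon> by (intro bexI[of _ z]) auto
      qed
      then obtain z' where z': "z' \<in> B" "dist z z' < \<epsilon>" "adj w l \<Longrightarrow> dist (X w) z' = s' {w, l}"
        by blast
      let ?X = "X(l := z')"
      have "dist (?X v) (?X u) = s' {v, u}" if vu: "v \<in> insert l W" "u \<in> insert l W" "adj v u" for u v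
      proof -
        consider "v = l" "u = w" | "u = l" "v = w" | "v \<in> W" "u \<in> W"
          using vu uniq sym irr by blast
        then show ?thesis
        proof cases
          case 1
          have "u \<noteq> l" "adj w l" using 1 l vu sym by auto
          then show ?thesis using 1 z' by (simp add: dist_commute insert_commute)
        next
          case 2
          have "v \<noteq> l" "adj w l" using 2 l vu by auto
          then show ?thesis using 2 z' by simp
        next
          case 3
          have "v \<noteq> l" "u \<noteq> l" using 3 l by auto
          then show ?thesis using 3 X vu by simp
        qed
      qed
      moreover have "?X ` insert l W \<subseteq> B" using X z' l by auto
      moreover have "?X r = x" using X r l by auto
      moreover have "\<forall>v\<in>insert l W. dist (?p v) (?X v) < \<epsilon>" using X z' l by auto
      ultimately show "realizable_near B x adj (insert l W) r ?p \<epsilon> s'"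
        unfolding realizable_near_def by blast
    qed
  qed
  have "r \<in> insert l W" using r by simp
  then show ?thesis
    unfolding robustly_realized_def using p' main by blast
qed

lemma edge_leaving:
  assumes "adj\<^sup>*\<^sup>* u v" "u \<in> W" "v \<notin> W"
  obtains w l where "w \<in> W" "l \<notin> W" "adj w l"
  using assms by (induction rule: rtranclp_induct) auto

text \<open>The tree is built up by adding one vertex at a time.  The pin becomes the vertex the
  construction starts from: only its position in the set matters, not its index.\<close>

lemma tree_robustly_realized:
  assumes tree: "tree V adj" and fin: "finite V" and x: "x \<in> B"
    and leaves: "robustly_leaves B"
  shows "robustly_realized B x adj V"
proof -
  have sym: "adj j i" and inV: "i \<in> V" "j \<in> V" and irr: "i \<noteq> j" if "adj i j" for i j
    using tree that unfolding tree_def simple_graph_def by auto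
  have acyclic: "\<nexists>p. graph_cycle adj p" using tree by (simp add: tree_def)
  have conn: "V \<noteq> {}" "\<And>i j. i \<in> V \<Longrightarrow> j \<in> V \<Longrightarrow> adj\<^sup>*\<^sup>* i j"
    using tree unfolding tree_def connected_graph_def by auto
  have grow: "\<exists>W\<subseteq>V. card W = Suc n \<and> path_linked adj W \<and> robustly_realized B x adj W"
    if "Suc n \<le> card V" for n
    using that
  proof (induction n)
    case 0
    obtain r where r: "r \<in> V" using conn by blast
    have no: "\<not> adj r r" using irr by blast
    have "path_linked adj {r}"
      unfolding path_linked_def by (auto intro!: exI[of _ "[r]"])
    moreover have "realizable_near B x adj {r} r (\<lambda>_. x) \<epsilon> s'" if "0 < \<epsilon>" for \<epsilon> s'
      unfolding realizable_near_def by (intro exI[of _ "\<lambda>_. x"]) (use x no that in auto)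
    then have "robustly_realized B x adj {r}"
      unfolding robustly_realized_def using x
      by (intro bexI[of _ r] exI[of _ "\<lambda>_. x"]) (auto intro: exI[of _ "1::real"])
    ultimately show ?case using r by (intro exI[of _ "{r}"]) auto
  next
    case (Suc n)
    then obtain W where W: "W \<subseteq> V" "card W = Suc n" "path_linked adj W" "robustly_realized B x adj W"
      by auto
    have finW: "finite W" using W(1) fin finite_subset by blast
    obtain u where u: "u \<in> W" using W(2) by fastforce
    have "W \<noteq> V" using W(2) Suc.prems by auto
    then obtain v where v: "v \<in> V" "v \<notin> W" using W(1) by blast
    obtain w l where wl: "w \<in> W" "l \<notin> W" "adj w l"
      using edge_leaving[of adj u v W] conn(2)[of u v] u v W(1) by blast
    have "path_linked adj (insert l W)"
      by (rule path_linked_insert[OF W(3) wl(2,1,3) sym])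
    moreover have "robustly_realized B x adj (insert l W)"
      by (rule robustly_realized_insert[OF W(4) finW leaves wl(2,1) _ sym])
        (use irr unique_neighbour[OF W(3) wl(2) acyclic sym wl(1,3)] in blast)+
    moreover have "card (insert l W) = Suc (Suc n)" using finW wl W(2) by simp
    moreover have "insert l W \<subseteq> V" using W(1) inV wl by auto
    ultimately show ?case by blast
  qed
  have "0 < card V" using conn(1) fin by (simp add: card_gt_0_iff)
  then obtain W where "W \<subseteq> V" "card W = card V" "robustly_realized B x adj W"
    using grow[of "card V - 1"] by auto
  then show ?thesis using card_subset_eq[OF fin, of W] by simp
qed

text \<open>The reference positions are distinct, so a realization close enough to them is injective,
  and the prescribed distances range over an open box.\<close>

lemma pinned_tree_distance_set_interior:
  fixes B :: "'b::real_normed_vector set"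
  assumes tree: "tree {1..k+1} adj" and x: "x \<in> B"
    and leaves: "robustly_leaves B"
  shows "powertop_real (graph_edges adj) interior_of pinned_tree_distance_set k adj x B \<noteq> {}"
proof -
  let ?V = "{1..k+1}" let ?E = "graph_edges adj"
  have sym: "adj j i" and inV: "i \<in> ?V" "j \<in> ?V" and irr: "i \<noteq> j" if "adj i j" for i j
    using tree that unfolding tree_def simple_graph_def by auto
  have "?E \<subseteq> ?V \<times> ?V" using inV by (auto simp: graph_edges_def)
  then have finE: "finite ?E" using finite_subset by blast
  have real: "robustly_realized B x adj ?V"
    by (rule tree_robustly_realized[OF tree _ x leaves]) simp
  obtain r p where r: "r \<in> ?V" and p: "p ` ?V \<subseteq> B" "inj_on p ?V"
    and ex: "\<forall>\<epsilon>>0. \<exists>s. \<exists>\<delta>>0. \<forall>s'. (\<forall>v\<in>?V. \<forall>w\<in>?V. adj v w \<longrightarrow> \<bar>s' {v, w} - s {v, w}\<bar> < \<delta>) \<longrightarrow>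
       realizable_near B x adj ?V r p \<epsilon> s'"
    by (rule robustly_realizedE[OF real])
  obtain \<epsilon> where \<epsilon>: "0 < \<epsilon>" "\<And>i j. i \<in> ?V \<Longrightarrow> j \<in> ?V \<Longrightarrow> i \<noteq> j \<Longrightarrow> 2 * \<epsilon> \<le> dist (p i) (p j)"
  proof -
    define D where "D = insert 1 ((\<lambda>(i, j). dist (p i) (p j)) ` {(i, j) \<in> ?V \<times> ?V. i \<noteq> j})"
    have "finite {(i, j) \<in> ?V \<times> ?V. i \<noteq> j}"
      by (rule finite_subset[of _ "?V \<times> ?V"]) auto
    then have D: "finite D" "D \<noteq> {}" by (simp_all add: D_def)
    have "0 < d" if "d \<in> D" for d using that p(2) by (auto simp: D_def inj_on_def)
    then have "0 < Min D" using Min_in[OF D] by blast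
    moreover have "2 * (Min D / 2) \<le> dist (p i) (p j)" if "i \<in> ?V" "j \<in> ?V" "i \<noteq> j" for i j
    proof -
      have "dist (p i) (p j) \<in> D" using that by (force simp: D_def)
      then show ?thesis using Min_le[OF D(1)] by simp
    qed
    ultimately show ?thesis using that[of "Min D / 2"] by auto
  qed
  obtain s \<delta> where \<delta>: "0 < \<delta>" and s: "\<And>s'. (\<forall>v\<in>?V. \<forall>w\<in>?V. adj v w \<longrightarrow> \<bar>s' {v, w} - s {v, w}\<bar> < \<delta>) \<Longrightarrow>
          realizable_near B x adj ?V r p \<epsilon> s'"
    using ex[rule_format, OF \<epsilon>(1)] by blast
  define U where "U = PiE ?E (\<lambda>(i, j). ball (s {i, j}) \<delta>)"
  have U_open: "openin (powertop_real ?E) U"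
    unfolding U_def by (subst openin_PiE[OF finE]) auto
  have "(\<lambda>(i, j)\<in>?E. s {i, j}) \<in> U" using \<delta> by (auto simp: U_def)
  moreover have "U \<subseteq> pinned_tree_distance_set k adj x B"
  proof
    fix f assume f: "f \<in> U"
    define s' where "s' e = f (Min e, Max e)" for e :: "nat set"
    have s'_eq: "s' {i, j} = f (i, j)" if "(i, j) \<in> ?E" for i j
      using that by (simp add: s'_def graph_edges_def)
    have "\<bar>s' {v, w} - s {v, w}\<bar> < \<delta>" if "(v, w) \<in> ?E" for v w
    proof -
      have "f (v, w) \<in> ball (s {v, w}) \<delta>" using f that by (fastforce simp: U_def)
      then show ?thesis using s'_eq[OF that] by (simp add: dist_real_def abs_minus_commute)
    qed
    then have lt: "\<bar>s' {v, w} - s {v, w}\<bar> < \<delta>" if "v < w" "adj v w" for v w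
      using that by (simp add: graph_edges_def)
    have "\<bar>s' {v, w} - s {v, w}\<bar> < \<delta>" if "adj v w" for v w
    proof (cases "v < w")
      case True
      then show ?thesis using lt that by blast
    next
      case False
      then have "w < v" using irr[OF that] by simp
      then show ?thesis using lt[OF _ sym[OF that]] by (simp add: insert_commute)
    qed
    then obtain X where X: "X ` ?V \<subseteq> B" "X r = x" "\<And>v. v \<in> ?V \<Longrightarrow> dist (p v) (X v) < \<epsilon>"
        "\<And>v w. v \<in> ?V \<Longrightarrow> w \<in> ?V \<Longrightarrow> adj v w \<Longrightarrow> dist (X v) (X w) = s' {v, w}"
      using s[of s'] unfolding realizable_near_def by blast
    have "inj_on X ?V"
    proof (rule inj_onI, rule ccontr)
      fix i j assume ij: "i \<in> ?V" "j \<in> ?V" "X i = X j" "i \<noteq> j"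
      have "dist (p i) (p j) \<le> dist (p i) (X i) + dist (p j) (X j)"
        using dist_triangle2[of "p i" "p j" "X i"] ij(3) by simp
      then show False using X(3)[OF ij(1)] X(3)[OF ij(2)] \<epsilon>(2)[OF ij(1,2,4)] by linarith
    qed
    moreover have "f = (\<lambda>(i, j)\<in>?E. norm (X i - X j))"
    proof (rule PiE_ext)
      show "f \<in> PiE ?E (\<lambda>_. UNIV)" using f by (auto simp: U_def PiE_def)
      show "(\<lambda>(i, j)\<in>?E. norm (X i - X j)) \<in> PiE ?E (\<lambda>_. UNIV)" by auto
      fix e assume "e \<in> ?E"
      moreover obtain i j where "e = (i, j)" by (cases e)
      ultimately have e: "e = (i, j)" "(i, j) \<in> ?E" "adj i j" by (auto simp: graph_edges_def)
      then show "f e = (\<lambda>(i, j)\<in>?E. norm (X i - X j)) e"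
        using X(4)[of i j] inV[OF e(3)] s'_eq[OF e(2)] by (simp add: dist_norm)
    qed
    ultimately show "f \<in> pinned_tree_distance_set k adj x B"
      unfolding pinned_tree_distance_set_def using X(1,2) r by blast
  qed
  ultimately show ?thesis using U_open interior_of_maximal by fastforce
qed

section \<open>Distances between gaps\<close>

lemma gap_properties:
  fixes C :: "'a::euclidean_space set"
  assumes C: "compact C" and G: "G \<in> gaps C"
  shows "open G" "connected G" "G \<noteq> {}" "G \<inter> C = {}" "frontier G \<subseteq> C"
proof -
  have op: "open (- C)" using C by (simp add: compact_imp_closed open_Compl)
  obtain x where x: "x \<in> - C" "G = path_component_set (- C) x" using G by (auto simp: gaps_def)
  show "open G" using x op by (simp add: open_path_component)
  have eq: "G = connected_component_set (- C) x"
    using x open_path_connected_component_set[OF op] by simp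
  then show "connected G" by simp
  have "x \<in> G" using eq x by simp
  then show "G \<noteq> {}" by blast
  show "G \<inter> C = {}" using eq connected_component_subset[of "- C" x] by blast
  have "frontier G \<subseteq> frontier (- C)" unfolding eq by (rule frontier_of_connected_component_subset)
  also have "\<dots> \<subseteq> C" using C by (simp add: frontier_complement frontier_subset_closed compact_imp_closed)
  finally show "frontier G \<subseteq> C" .
qed

lemma thickness_le_gap_ratio:
  assumes C: "compact C" and I: "gap_ordering C I G" "n \<in> I"
  shows "thickness C \<le> ennreal (setdist (G n) ((\<Union>i\<in>{1..<n}. G i) \<union> unbounded_gap C) / diameter (G n))"
proof -
  have "bounded_gaps C \<noteq> {}" using I by (auto simp: gap_ordering_def bij_betw_def)
  then have "thickness C = thickness_along C I G" using thickness_eq[OF C I(1)] by blast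
  then show ?thesis unfolding thickness_along_def using I(2) by (auto intro: INF_lower)
qed

lemma thickness_finite:
  assumes "compact C" "bounded_gaps C \<noteq> {}"
  shows "thickness C \<noteq> \<infinity>"
proof (cases "\<exists>I G. gap_ordering C I G")
  case True
  then obtain I G where G: "gap_ordering C I G" by blast
  then obtain n where "n \<in> I" using assms(2) by (fastforce simp: gap_ordering_def bij_betw_def)
  then show ?thesis using thickness_le_gap_ratio[OF assms(1) G] by (metis ennreal_neq_top infinity_ennreal_def top_unique)
next
  case False
  then have "thickness C = 0" using assms(2) by (auto simp: thickness_def)
  then show ?thesis by simp
qed

lemma finite_positive_thickness:
  fixes C :: "'a::euclidean_space set"
  assumes "compact C" "interior C = {}" "0 < thickness C"
  obtains t where "0 < t" "ennreal t = thickness C"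
proof -
  have "bounded_gaps C \<noteq> {}" using assms by (auto simp: thickness_def)
  then have "thickness C \<noteq> \<infinity>" using thickness_finite assms(1) by blast
  then have "0 < enn2real (thickness C)" "ennreal (enn2real (thickness C)) = thickness C"
    using assms(3) by (auto simp: enn2real_positive_iff top.not_eq_extremum infinity_ennreal_def)
  then show ?thesis using that by blast
qed

text \<open>Of two bounded gaps, the one that comes later in the ordering is the smaller one, and its
  ratio involves the distance to the other.\<close>

lemma thickness_gap_distances:
  fixes C :: "'a::euclidean_space set"
  assumes C: "compact C" and t: "0 \<le> t" "ennreal t \<le> thickness C" and G: "G \<in> bounded_gaps C"
  shows "t * diameter G \<le> setdist G (unbounded_gap C)"
    and "G' \<in> bounded_gaps C \<Longrightarrow> G \<noteq> G' \<Longrightarrow> t * min (diameter G) (diameter G') \<le> setdist G G'"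
proof -
  have "t * diameter G \<le> setdist G (unbounded_gap C) \<and>
    (G' \<in> bounded_gaps C \<longrightarrow> G \<noteq> G' \<longrightarrow> t * min (diameter G) (diameter G') \<le> setdist G G')"
  proof (cases "\<exists>I H. gap_ordering C I H")
    case False
    then have "thickness C = 0" using G by (auto simp: thickness_def)
    then have "t = 0" using t by (simp add: ennreal_eq_0_iff)
    then show ?thesis by (simp add: setdist_pos_le)
  next
    case True
    then obtain I H where H: "gap_ordering C I H" by blast
    have inI: "\<exists>n\<in>I. K = H n" if "K \<in> bounded_gaps C" for K
      using H that unfolding gap_ordering_def bij_betw_def by blast
    have bd: "H n \<in> bounded_gaps C" if "n \<in> I" for n
      using H that by (auto simp: gap_ordering_def bij_betw_def)
    have le: "t * diameter (H n) \<le> setdist (H n) ((\<Union>i\<in>{1..<n}. H i) \<union> unbounded_gap C)"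
      if n: "n \<in> I" for n
    proof -
      let ?d = "setdist (H n) ((\<Union>i\<in>{1..<n}. H i) \<union> unbounded_gap C)"
      have d0: "0 \<le> diameter (H n)" using bd[OF n] by (auto simp: bounded_gaps_def intro: diameter_ge_0)
      then have "0 \<le> ?d / diameter (H n)" by (simp add: setdist_pos_le)
      moreover have "ennreal t \<le> ennreal (?d / diameter (H n))"
        using t(2) thickness_le_gap_ratio[OF C H n] by (rule order_trans)
      ultimately have le: "t \<le> ?d / diameter (H n)" by (simp add: ennreal_le_iff)
      show ?thesis
      proof (cases "diameter (H n) = 0")
        case False
        then show ?thesis using le d0 by (simp add: field_simps)
      qed (simp add: setdist_pos_le)
    qed
    have ne: "H n \<noteq> {}" if "n \<in> I" for n
      using bd[OF that] gap_properties[OF C] by (auto simp: bounded_gaps_def)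
    have later: "t * diameter (H n) \<le> setdist (H n) (H m)" if "n \<in> I" "m \<in> I" "m < n" for m n
    proof -
      have "1 \<le> m" using H that by (auto simp: gap_ordering_def)
      then have "setdist (H n) ((\<Union>i\<in>{1..<n}. H i) \<union> unbounded_gap C) \<le> setdist (H n) (H m)"
        using that ne by (intro setdist_subset_right) auto
      then show ?thesis using le[OF that(1)] by linarith
    qed
    obtain n where n: "n \<in> I" "G = H n" using inI G by blast
    have "setdist (H n) ((\<Union>i\<in>{1..<n}. H i) \<union> unbounded_gap C) \<le> setdist (H n) (unbounded_gap C)"
      using unbounded_gap_nonempty[OF C] by (intro setdist_subset_right) auto
    then have 1: "t * diameter G \<le> setdist G (unbounded_gap C)" using le[OF n(1)] unfolding n(2) by linarith
    have 2: "t * min (diameter G) (diameter G') \<le> setdist G G'" if G': "G' \<in> bounded_gaps C" "G \<noteq> G'"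
    proof -
      obtain m where m: "m \<in> I" "G' = H m" using inI G' by blast
      have "t * min (diameter G) (diameter G') \<le> t * diameter G"
           "t * min (diameter G) (diameter G') \<le> t * diameter G'"
        using t by (auto intro!: mult_left_mono)
      moreover have "m < n \<or> n < m" using n m G' by (metis linorder_cases)
      ultimately show ?thesis
        using later[OF n(1) m(1)] later[OF m(1) n(1)] n m by (auto simp: setdist_sym)
    qed
    show ?thesis using 1 2 by blast
  qed
  then show "t * diameter G \<le> setdist G (unbounded_gap C)"
    "G' \<in> bounded_gaps C \<Longrightarrow> G \<noteq> G' \<Longrightarrow> t * min (diameter G) (diameter G') \<le> setdist G G'"
    by blast+
qed

section \<open>Reaching points of a product\<close>

text \<open>If a connected set \<open>K\<close> near \<open>u\<close> does not lie on a sphere about \<open>a\<close>, then the distances from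
  points near \<open>(a, b)\<close> to \<open>K \<times> {v}\<close> cover a fixed interval, by the intermediate value theorem.\<close>

lemma robustly_reaches_of_connected:
  fixes C1 :: "'a::euclidean_space set" and C2 :: "'b::euclidean_space set"
  assumes v: "v \<in> C2"
    and K: "\<And>\<epsilon>. 0 < \<epsilon> \<Longrightarrow> \<exists>K k1 k2. connected K \<and> K \<subseteq> C1 \<and> K \<subseteq> ball u \<epsilon> \<and>
              k1 \<in> K \<and> k2 \<in> K \<and> dist a k1 < dist a k2"
  shows "robustly_reaches (C1 \<times> C2) (a, b) (u, v)"
  unfolding robustly_reaches_def
proof (intro allI impI)
  fix \<epsilon> :: real assume "0 < \<epsilon>"
  then obtain K k1 k2 where K: "connected K" "K \<subseteq> C1" "K \<subseteq> ball u \<epsilon>"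
    and k: "k1 \<in> K" "k2 \<in> K" "dist a k1 < dist a k2"
    using K by meson
  define s where "s = (dist (a, b) (k1, v) + dist (a, b) (k2, v)) / 2"
  define W where "W = {z. dist (fst z) (k1, v) < snd z \<and> snd z < dist (fst z) (k2, v)}"
  have "dist (a, b) (k1, v) < dist (a, b) (k2, v)"
    using k(3) by (simp add: dist_Pair_Pair power_strict_mono)
  then have "((a, b), s) \<in> W" by (simp add: W_def s_def)
  moreover have "open W"
    unfolding W_def by (intro open_Collect_conj open_Collect_less continuous_intros)
  ultimately have "\<forall>\<^sub>F z in nhds ((a, b), s). z \<in> W" by (intro eventually_nhds_in_open)
  then have "\<forall>\<^sub>F (y', s') in nhds ((a, b), s). \<exists>z'\<in>C1 \<times> C2. dist (u, v) z' < \<epsilon> \<and> dist y' z' = s'"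
  proof (rule eventually_mono, clarify)
    fix a' b' s' assume "((a', b'), s') \<in> W"
    then have s': "dist (a', b') (k1, v) < s'" "s' < dist (a', b') (k2, v)" by (auto simp: W_def)
    let ?f = "\<lambda>k. dist (a', b') (k, v)"
    have "connected (?f ` K)"
      using K(1) by (intro connected_continuous_image continuous_intros)
    then have "s' \<in> ?f ` K"
      using connectedD_interval[of "?f ` K" "?f k1" "?f k2" s'] k s' by auto
    then obtain k where "k \<in> K" "?f k = s'" by blast
    moreover have "dist (u, v) (k, v) < \<epsilon>" using K(3) \<open>k \<in> K\<close> by (auto simp: dist_Pair_Pair)
    ultimately show "\<exists>z'\<in>C1 \<times> C2. dist (u, v) z' < \<epsilon> \<and> dist (a', b') z' = s'"
      using K(2) v by (intro bexI[of _ "(k, v)"]) auto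
  qed
  then show "\<exists>s. \<forall>\<^sub>F (y', s') in nhds ((a, b), s). \<exists>z'\<in>C1 \<times> C2. dist (u, v) z' < \<epsilon> \<and> dist y' z' = s'"
    by blast
qed

lemma robustly_leaves_if_interior:
  fixes C1 :: "'a::euclidean_space set" and C2 :: "'b::euclidean_space set"
  assumes int: "interior C1 \<noteq> {}"
  shows "robustly_leaves (C1 \<times> C2)"
  unfolding robustly_leaves_def
proof (intro ballI allI impI)
  fix y F assume y: "y \<in> C1 \<times> C2" and F: "finite (F :: ('a \<times> 'b) set)"
  obtain a b where ab: "y = (a, b)" "b \<in> C2" using y by blast
  have "infinite (interior C1)" using int finite_imp_not_open open_interior by blast
  then have "infinite (interior C1 - insert a (fst ` F))" using F by (simp add: Diff_infinite_finite)
  then obtain u where u: "u \<in> interior C1 - insert a (fst ` F)"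
    using infinite_imp_nonempty by blast
  have "robustly_reaches (C1 \<times> C2) (a, b) (u, b)"
  proof (rule robustly_reaches_of_connected[OF ab(2)])
    fix \<epsilon> :: real assume \<epsilon>: "0 < \<epsilon>"
    obtain r where r: "0 < r" "ball u r \<subseteq> C1" using u by (auto simp: mem_interior)
    define c where "c = min r \<epsilon> / 2 / norm (u - a)"
    have n: "0 < norm (u - a)" using u by auto
    have c: "0 < c" "c * norm (u - a) < min r \<epsilon>" using n r \<epsilon> by (auto simp: c_def)
    let ?k = "u + c *\<^sub>R (u - a)"
    have "a - ?k = (- (1 + c)) *\<^sub>R (u - a)" by (simp add: algebra_simps)
    then have "dist a ?k = (1 + c) * norm (u - a)" using c by (simp add: dist_norm)
    moreover have "1 * norm (u - a) < (1 + c) * norm (u - a)" using c n by (intro mult_strict_right_mono) auto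
    ultimately have "dist a u < dist a ?k" by (simp add: dist_norm norm_minus_commute)
    moreover have "?k \<in> ball u (min r \<epsilon>)" using c by (simp add: dist_norm)
    moreover have "ball u (min r \<epsilon>) \<subseteq> C1" using r by auto
    ultimately show "\<exists>K k1 k2. connected K \<and> K \<subseteq> C1 \<and> K \<subseteq> ball u \<epsilon> \<and> k1 \<in> K \<and> k2 \<in> K \<and> dist a k1 < dist a k2"
      using r \<epsilon> by (intro exI[of _ "ball u (min r \<epsilon>)"] exI[of _ u] exI[of _ ?k]) auto
  qed
  moreover have "(u, b) \<in> C1 \<times> C2 - F" using u ab interior_subset[of C1] by force
  ultimately show "\<exists>z\<in>C1 \<times> C2 - F. robustly_reaches (C1 \<times> C2) y z" unfolding ab(1) by blast
qed

lemma robustly_reaches_swap: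
  fixes C1 :: "'a::euclidean_space set" and C2 :: "'b::euclidean_space set"
  assumes "robustly_reaches (C2 \<times> C1) (b, a) (v, u)"
  shows "robustly_reaches (C1 \<times> C2) (a, b) (u, v)"
  unfolding robustly_reaches_def
proof (intro allI impI)
  fix \<epsilon> :: real assume "0 < \<epsilon>"
  then obtain s where "\<forall>\<^sub>F (y', s') in nhds ((b, a), s). \<exists>z'\<in>C2 \<times> C1. dist (v, u) z' < \<epsilon> \<and> dist y' z' = s'"
    using assms unfolding robustly_reaches_def by blast
  then have s: "\<forall>\<^sub>F z in nhds ((b, a), s). \<exists>z'\<in>C2 \<times> C1. dist (v, u) z' < \<epsilon> \<and> dist (fst z) z' = snd z"
    unfolding case_prod_beta .
  have "((\<lambda>z::('a \<times> 'b) \<times> real. ((snd (fst z), fst (fst z)), snd z)) \<longlongrightarrow>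
      ((snd (fst ((a, b), s)), fst (fst ((a, b), s))), snd ((a, b), s))) (nhds ((a, b), s))"
    by (intro tendsto_Pair tendsto_fst tendsto_snd filterlim_ident)
  then have "filterlim (\<lambda>z. ((snd (fst z), fst (fst z)), snd z)) (nhds ((b, a), s)) (nhds ((a, b), s))"
    by simp
  from eventually_compose_filterlim[OF s this]
  have "\<forall>\<^sub>F (y', s') in nhds ((a, b), s). \<exists>z'\<in>C1 \<times> C2. dist (u, v) z' < \<epsilon> \<and> dist y' z' = s'"
  proof (rule eventually_mono, clarsimp)
    fix a' b' s' v' u' assume h: "v' \<in> C2" "u' \<in> C1" "dist (v, u) (v', u') < \<epsilon>" 
    have sw: "dist (u, v) (u', v') = dist (v, u) (v', u')" "dist (a', b') (u', v') = dist (b', a') (v', u')" for a' b'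
      by (simp_all add: dist_Pair_Pair add.commute)
    show "\<exists>x\<in>C1. \<exists>y\<in>C2. dist (u, v) (x, y) < \<epsilon> \<and> dist (a', b') (x, y) = dist (b', a') (v', u')"
      using h sw by (intro bexI[of _ u'] bexI[of _ v']) auto
  qed
  then show "\<exists>s. \<forall>\<^sub>F (y', s') in nhds ((a, b), s). \<exists>z'\<in>C1 \<times> C2. dist (u, v) z' < \<epsilon> \<and> dist y' z' = s'"
    by blast
qed

lemma robustly_leaves_swap:
  fixes C1 :: "'a::euclidean_space set" and C2 :: "'b::euclidean_space set"
  assumes "robustly_leaves (C2 \<times> C1)"
  shows "robustly_leaves (C1 \<times> C2)"
  unfolding robustly_leaves_def
proof (intro ballI allI impI)
  fix y F assume "y \<in> C1 \<times> C2" and F: "finite (F :: ('a \<times> 'b) set)"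
  then obtain a b where ab: "y = (a, b)" "(b, a) \<in> C2 \<times> C1" by blast
  obtain z where z: "z \<in> C2 \<times> C1 - prod.swap ` F" "robustly_reaches (C2 \<times> C1) (b, a) z"
    using assms ab(2) F unfolding robustly_leaves_def by blast
  obtain v u where vu: "z = (v, u)" by (cases z)
  have "(u, v) \<in> C1 \<times> C2 - F" using z(1) vu by (auto simp: image_iff)
  then show "\<exists>z\<in>C1 \<times> C2 - F. robustly_reaches (C1 \<times> C2) y z"
    using robustly_reaches_swap z(2) unfolding ab(1) vu by blast
qed

subsection \<open>Dimension at least two\<close>

definition outer_boundary :: "'a::euclidean_space set \<Rightarrow> 'a set" where
  "outer_boundary G = frontier (outside (closure G))"

text \<open>The outer boundary of a bounded gap is a continuum in the set, as the frontier of a component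
  of the complement of a connected set is connected.\<close>

lemma outer_boundary:
  fixes C :: "'a::euclidean_space set"
  assumes dim: "2 \<le> DIM('a)" and C: "compact C" and G: "G \<in> bounded_gaps C"
  shows "connected (outer_boundary G)" "outer_boundary G \<subseteq> C" "outer_boundary G \<subseteq> closure G"
proof -
  have "G \<in> gaps C" and bd: "bounded G" using G by (auto simp: bounded_gaps_def)
  note gap = gap_properties[OF C this(1)]
  have "outside (closure G) \<noteq> {}" using bd unbounded_outside[of "closure G"] by fastforce
  moreover have "connected (outside (closure G))" using bd dim by (intro connected_outside) auto
  ultimately have "outside (closure G) \<in> components (- closure G)" by (simp add: outside_in_components)
  then show "connected (outer_boundary G)"
    unfolding outer_boundary_def
    using connected_frontier_component_complement gap(2) connected_imp_connected_closure by blast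
  show cl: "outer_boundary G \<subseteq> closure G"
    unfolding outer_boundary_def by (intro frontier_outside_subset) simp
  have "outside (closure G) \<inter> G = {}" using outside_no_overlap[of "closure G"] closure_subset[of G] by blast
  then have "closure (outside (closure G)) \<inter> G = {}"
    using open_Int_closure_eq_empty[OF gap(1), of "outside (closure G)"] by blast
  then have "outer_boundary G \<subseteq> closure G - G" using cl by (auto simp: outer_boundary_def frontier_def)
  also have "\<dots> = frontier G" using gap(1) by (simp add: frontier_def interior_open)
  also have "\<dots> \<subseteq> C" by (rule gap(5))
  finally show "outer_boundary G \<subseteq> C" .
qed

lemma ray_meets_outer_boundary:
  fixes C :: "'a::euclidean_space set"
  assumes C: "compact C" and G: "G \<in> bounded_gaps C" and g: "g \<in> G" and d: "d \<noteq> 0"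
    and dim: "2 \<le> DIM('a)"
  obtains t where "0 < t" "g + t *\<^sub>R d \<in> outer_boundary G"
proof -
  have bd: "bounded (closure G)" using G by (auto simp: bounded_gaps_def)
  have "\<not> bounded ((\<lambda>t. g + t *\<^sub>R d) ` {0..})"
  proof
    assume "bounded ((\<lambda>t. g + t *\<^sub>R d) ` {0..})"
    then obtain B where B: "\<And>t. 0 \<le> t \<Longrightarrow> norm (g + t *\<^sub>R d) \<le> B" by (auto simp: bounded_iff)
    define t where "t = (norm g + \<bar>B\<bar> + 1) / norm d"
    have t: "0 \<le> t" "t * norm d = norm g + \<bar>B\<bar> + 1" using d by (auto simp: t_def)
    have "norm (t *\<^sub>R d) \<le> norm (g + t *\<^sub>R d) + norm g" using norm_triangle_ineq4[of "g + t *\<^sub>R d" g] by simp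
    then show False using B[OF t(1)] t by simp
  qed
  then have "\<not> (\<lambda>t. g + t *\<^sub>R d) ` {0..} \<subseteq> - outside (closure G)"
    using bounded_subset[OF cobounded_outside[OF bd]] by blast
  then obtain T where T: "0 \<le> T" "g + T *\<^sub>R d \<in> outside (closure G)" by auto
  let ?S = "(\<lambda>t. g + t *\<^sub>R d) ` {0..T}"
  have gin: "g \<in> closure G" using g closure_subset by blast
  have "?S \<inter> frontier (outside (closure G)) \<noteq> {}"
  proof (rule connected_Int_frontier)
    show "connected ?S" by (intro connected_continuous_image continuous_intros) simp
    have "g + T *\<^sub>R d \<in> ?S" using T(1) by (intro imageI) simp
    then show "?S \<inter> outside (closure G) \<noteq> {}" using T(2) by blast
    have "g \<notin> outside (closure G)" using gin outside_no_overlap[of "closure G"] by blast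
    moreover have "g \<in> ?S" using T by (auto simp: image_iff intro!: bexI[of _ 0])
    ultimately show "?S - outside (closure G) \<noteq> {}" by blast
  qed
  then obtain t where t: "0 \<le> t" "g + t *\<^sub>R d \<in> outer_boundary G" by (auto simp: outer_boundary_def)
  have "g \<notin> C" using g G gap_properties(4)[OF C] by (auto simp: bounded_gaps_def)
  then have "t \<noteq> 0" using t outer_boundary(2)[OF dim C G] by auto
  then show ?thesis using that[of t] t by simp
qed

text \<open>The two points where the line through \<open>a\<close> and a point of the gap leaves the gap for the last
  time have different distances from \<open>a\<close>: one lies between \<open>a\<close> and the gap, the other beyond it.\<close>

lemma outer_boundary_not_spherical:
  fixes C :: "'a::euclidean_space set"
  assumes dim: "2 \<le> DIM('a)" and C: "compact C" and G: "G \<in> bounded_gaps C"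
    and D: "closure G \<subseteq> D" "convex D" "a \<notin> D"
  obtains k1 k2 where "k1 \<in> outer_boundary G" "k2 \<in> outer_boundary G" "dist a k1 < dist a k2"
proof -
  obtain g where g: "g \<in> G" using G gap_properties(3)[OF C] by (auto simp: bounded_gaps_def)
  have gD: "g \<in> D" using g D(1) closure_subset by blast
  then have ne: "g - a \<noteq> 0" "a - g \<noteq> 0" using D(3) by auto
  obtain s where s: "0 < s" "g + s *\<^sub>R (a - g) \<in> outer_boundary G"
    by (rule ray_meets_outer_boundary[OF C G g ne(2) dim])
  obtain t where t: "0 < t" "g + t *\<^sub>R (g - a) \<in> outer_boundary G"
    by (rule ray_meets_outer_boundary[OF C G g ne(1) dim])
  have "s < 1"
  proof (rule ccontr)
    assume "\<not> s < 1"
    then have s1: "1 \<le> s" by simp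
    have "g + s *\<^sub>R (a - g) \<in> D" using s(2) outer_boundary(3)[OF dim C G] D(1) by blast
    then have "(1 - 1 / s) *\<^sub>R g + (1 / s) *\<^sub>R (g + s *\<^sub>R (a - g)) \<in> D"
      using s1 by (intro convexD_alt[OF D(2) gD]) auto
    moreover have "(1 - 1 / s) *\<^sub>R g + (1 / s) *\<^sub>R (g + s *\<^sub>R (a - g)) = a"
      using s(1) by (simp add: algebra_simps)
    ultimately show False using D(3) by simp
  qed
  moreover have "a - (g + s *\<^sub>R (a - g)) = (1 - s) *\<^sub>R (a - g)" by (simp add: algebra_simps)
  then have "dist a (g + s *\<^sub>R (a - g)) = \<bar>1 - s\<bar> * norm (a - g)" by (simp add: dist_norm)
  ultimately have "dist a (g + s *\<^sub>R (a - g)) < norm (a - g)"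
    using s ne by simp
  moreover have "a - (g + t *\<^sub>R (g - a)) = (1 + t) *\<^sub>R (a - g)" by (simp add: algebra_simps)
  then have "dist a (g + t *\<^sub>R (g - a)) = \<bar>1 + t\<bar> * norm (a - g)" by (simp add: dist_norm)
  then have "norm (a - g) < dist a (g + t *\<^sub>R (g - a))" using t ne by simp
  ultimately show ?thesis using that s(2) t(2) by (meson less_trans)
qed

text \<open>Just outside the outer boundary there must be other gaps, since the set has no interior and
  the unbounded gap is at a positive distance.  Such a gap is close to \<open>G\<close>, hence small.\<close>

lemma small_gaps_at_outer_boundary:
  fixes C :: "'a::euclidean_space set"
  assumes dim: "2 \<le> DIM('a)" and C: "compact C" and int: "interior C = {}"
    and t: "0 < t" "ennreal t \<le> thickness C"
    and G: "G \<in> bounded_gaps C" and p: "p \<in> outer_boundary G" and \<eta>: "0 < \<eta>"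
  obtains G' where "G' \<in> bounded_gaps C" "closure G' \<subseteq> ball p \<eta>"
proof -
  have "G \<in> gaps C" and bd: "bounded G" using G by (auto simp: bounded_gaps_def)
  note gap = gap_properties[OF C this(1)]
  have dG: "0 < diameter G"
  proof -
    obtain g r where "0 < r" "cball g r \<subseteq> G" using gap(1,3) by (meson ex_in_conv open_contains_cball)
    then show ?thesis using diameter_subset[of "cball g r" G] bd by simp
  qed
  (* the first bound keeps points within \<zeta> of p out of the unbounded gap and forces their gaps to be
     smaller than G; the others make these gaps fit into the ball *)
  define \<zeta> where "\<zeta> = min (t * diameter G) (min (\<eta> / 4) (t * \<eta> / 4))"
  have \<zeta>: "0 < \<zeta>" "\<zeta> \<le> t * diameter G" "\<zeta> \<le> \<eta> / 4" "\<zeta> \<le> t * \<eta> / 4"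
    using t \<eta> dG by (auto simp: \<zeta>_def)
  let ?O = "ball p \<zeta> \<inter> outside (closure G)"
  have "open ?O" by (intro open_Int open_outside) auto
  moreover have "?O \<noteq> {}"
    using p \<zeta>(1) unfolding outer_boundary_def frontier_straddle by (force simp: disjoint_iff)
  ultimately have "\<not> ?O \<subseteq> C" using int by (metis interior_maximal subset_empty)
  then obtain x where "x \<in> ?O" "x \<notin> C" by blast
  then have x: "dist p x < \<zeta>" "x \<in> outside (closure G)" "x \<notin> C" by auto
  define G' where "G' = path_component_set (- C) x"
  have xG': "x \<in> G'" using x(3) by (simp add: G'_def path_component_refl)
  have pG: "p \<in> closure G" using outer_boundary(3)[OF dim C G] p by blast
  have gG': "G' \<in> gaps C" using x(3) by (simp add: gaps_def G'_def)
  have near: "setdist G A < \<zeta>" if "x \<in> A" for A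
  proof -
    have "setdist G A = setdist (closure G) A" by simp
    also have "\<dots> \<le> dist p x" using pG that by (rule setdist_le_dist)
    finally show ?thesis using x(1) by simp
  qed
  have bd': "bounded G'"
  proof (rule ccontr)
    assume "\<not> bounded G'"
    then have "x \<in> unbounded_gap C" using gG' xG' by (auto simp: unbounded_gap_def)
    then show False using near thickness_gap_distances(1)[OF C _ t(2) G] t(1) \<zeta>(2) by fastforce
  qed
  then have G': "G' \<in> bounded_gaps C" using gG' by (simp add: bounded_gaps_def)
  have "x \<notin> G" using x(2) outside_no_overlap[of "closure G"] closure_subset[of G] by blast
  then have "t * min (diameter G) (diameter G') \<le> setdist G G'"
    using thickness_gap_distances(2)[OF C _ t(2) G G'] t(1) xG' by force
  then have less: "t * min (diameter G) (diameter G') < \<zeta>" using near[OF xG'] by linarith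
  then have "min (diameter G) (diameter G') = diameter G'" using \<zeta>(2) by (auto simp: min_def)
  then have "t * diameter G' < t * (\<eta> / 4)" using less \<zeta>(4) by simp
  then have dG': "diameter G' < \<eta> / 4" using t(1) by simp
  have "closure G' \<subseteq> ball p \<eta>"
  proof
    fix y assume "y \<in> closure G'"
    moreover have "x \<in> closure G'" using xG' closure_subset by blast
    ultimately have "dist x y \<le> diameter (closure G')" using bd' by (intro diameter_bounded_bound) auto
    then have "dist x y < \<eta> / 4" using dG' diameter_closure[OF bd'] by simp
    then show "y \<in> ball p \<eta>" using dist_triangle[of p y x] x(1) \<zeta>(3) \<eta> by simp
  qed
  then show ?thesis using that G' by blast
qed

lemma robustly_leaves_dim_ge_2:
  fixes C1 C2 :: "'a::euclidean_space set"
  assumes dim: "2 \<le> DIM('a)" and C: "compact C1" and th: "0 < thickness C1"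
  shows "robustly_leaves (C1 \<times> C2)"
proof (cases "interior C1 = {}")
  case False
  then show ?thesis by (rule robustly_leaves_if_interior)
next
  case int: True
  have "bounded_gaps C1 \<noteq> {}" using th int by (auto simp: thickness_def)
  then obtain G where G: "G \<in> bounded_gaps C1" by blast
  obtain t where t: "0 < t" "ennreal t \<le> thickness C1"
    using finite_positive_thickness[OF C int th] by (metis order_refl)
  have inf: "infinite (outer_boundary G)"
  proof -
    obtain g where g: "g \<in> G" using G gap_properties(3)[OF C] by (auto simp: bounded_gaps_def)
    obtain d :: 'a where d: "d \<noteq> 0" using nonzero_Basis by blast
    obtain s where s: "0 < s" "g + s *\<^sub>R d \<in> outer_boundary G"
      by (rule ray_meets_outer_boundary[OF C G g d dim])
    have "- d \<noteq> 0" using d by simp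
    then obtain s' where s': "0 < s'" "g + s' *\<^sub>R (- d) \<in> outer_boundary G"
      by (rule ray_meets_outer_boundary[OF C G g _ dim])
    have "(s + s') *\<^sub>R d \<noteq> 0" using s s' d by simp
    then have "g + s *\<^sub>R d \<noteq> g + s' *\<^sub>R (- d)" by (simp add: algebra_simps eq_neg_iff_add_eq_0)
    then show ?thesis
      using connected_finite_iff_sing[OF outer_boundary(1)[OF dim C G]] s(2) s'(2) by auto
  qed
  show ?thesis
    unfolding robustly_leaves_def
  proof (intro ballI allI impI)
    fix y F assume y: "y \<in> C1 \<times> C2" and F: "finite (F :: ('a \<times> 'a) set)"
    obtain a b where ab: "y = (a, b)" "b \<in> C2" using y by blast
    have "infinite (outer_boundary G - insert a (fst ` F))" using F inf by (simp add: Diff_infinite_finite)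
    then obtain u where u: "u \<in> outer_boundary G - insert a (fst ` F)"
      using infinite_imp_nonempty by blast
    have "robustly_reaches (C1 \<times> C2) (a, b) (u, b)"
    proof (rule robustly_reaches_of_connected[OF ab(2)])
      fix \<epsilon> :: real assume "0 < \<epsilon>"
      then have "0 < min \<epsilon> (dist u a)" using u by auto
      then obtain G' where G': "G' \<in> bounded_gaps C1" "closure G' \<subseteq> ball u (min \<epsilon> (dist u a))"
        using small_gaps_at_outer_boundary[OF dim C int t G, of u] u by blast
      obtain k1 k2 where "k1 \<in> outer_boundary G'" "k2 \<in> outer_boundary G'" "dist a k1 < dist a k2"
        by (rule outer_boundary_not_spherical[OF dim C G'(1) G'(2) convex_ball, of a]) auto
      then show "\<exists>K k1 k2. connected K \<and> K \<subseteq> C1 \<and> K \<subseteq> ball u \<epsilon> \<and> k1 \<in> K \<and> k2 \<in> K \<and> dist a k1 < dist a k2"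
        using outer_boundary[OF dim C G'(1)] G'(2)
        by (intro exI[of _ "outer_boundary G'"] exI[of _ k1] exI[of _ k2]) auto
    qed
    moreover have "(u, b) \<in> C1 \<times> C2 - F" using u ab outer_boundary(2)[OF dim C G] by force
    ultimately show "\<exists>z\<in>C1 \<times> C2 - F. robustly_reaches (C1 \<times> C2) y z" unfolding ab(1) by blast
  qed
qed

subsection \<open>Dimension one\<close>

text \<open>The real lemmas look for points to the right of a given one.  As the set may extend to only
  one side of \<open>a\<close>, the orientation of the line depends on where another point \<open>c\<close> lies.\<close>

lemma line_coordinate:
  fixes a c :: "'a::euclidean_space"
  assumes dim: "DIM('a) = 1" and ac: "a \<noteq> c"
  obtains e :: 'a where "\<And>x. (x \<bullet> e) *\<^sub>R e = x" "norm e = 1" "a \<bullet> e < c \<bullet> e"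
proof -
  obtain b :: 'a where b: "Basis = {b}" using dim card_1_singletonE by blast
  then have rep: "(x \<bullet> b) *\<^sub>R b = x" for x
    using euclidean_representation[of x] by (simp add: b)
  have "b \<in> Basis" by (simp add: b)
  then have nb: "norm b = 1" by (rule norm_Basis)
  have "(c - a) \<bullet> b \<noteq> 0" using rep[of "c - a"] ac by auto
  then consider "a \<bullet> b < c \<bullet> b" | "a \<bullet> (- b) < c \<bullet> (- b)"
    by (fastforce simp: inner_diff_left)
  then show ?thesis
  proof cases
    case 1
    then show ?thesis using that[of b] rep nb by blast
  next
    case 2
    then show ?thesis using that[of "- b"] rep nb by simp
  qed
qed

context
  fixes e :: "'a::euclidean_space"
  assumes rep: "\<And>x. (x \<bullet> e) *\<^sub>R e = x" and unit: "norm e = 1"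
begin

lemma inner_unit: "e \<bullet> e = 1"
  using unit by (simp add: dot_square_norm)

lemma inner_scaleR_unit: "(r *\<^sub>R e) \<bullet> e = r"
  by (simp add: inner_unit)

lemma dist_coordinate: "dist x y = \<bar>x \<bullet> e - y \<bullet> e\<bar>"
proof -
  have "x - y = ((x - y) \<bullet> e) *\<^sub>R e" using rep[of "x - y"] by simp
  then have "norm (x - y) = \<bar>(x - y) \<bullet> e\<bar> * norm e" by (metis norm_scaleR)
  then show ?thesis using unit by (simp add: dist_norm inner_diff_left)
qed

lemma coordinate_vimage: "{x. x \<bullet> e \<in> T} = (\<lambda>r. r *\<^sub>R e) ` T"
proof
  show "{x. x \<bullet> e \<in> T} \<subseteq> (\<lambda>r. r *\<^sub>R e) ` T"
  proof
    fix x assume "x \<in> {x. x \<bullet> e \<in> T}"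
    then show "x \<in> (\<lambda>r. r *\<^sub>R e) ` T" using rep[of x] by (intro image_eqI[of _ _ "x \<bullet> e"]) auto
  qed
qed (auto simp: inner_unit)

lemma closure_coordinate_vimage:
  assumes "r \<in> closure T"
  shows "r *\<^sub>R e \<in> closure {x. x \<bullet> e \<in> T}"
proof -
  have "continuous_on UNIV (\<lambda>r. r *\<^sub>R e)" by (intro continuous_intros)
  then have "(\<lambda>r. r *\<^sub>R e) ` closure T \<subseteq> closure ((\<lambda>r. r *\<^sub>R e) ` T)"
    by (rule continuous_image_closure_subset) simp
  then show ?thesis using assms unfolding coordinate_vimage by blast
qed

lemma coordinate_mem: "r \<in> (\<lambda>x. x \<bullet> e) ` C \<longleftrightarrow> r *\<^sub>R e \<in> C"
proof
  assume "r \<in> (\<lambda>x. x \<bullet> e) ` C"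
  then show "r *\<^sub>R e \<in> C" using rep by auto
next
  assume "r *\<^sub>R e \<in> C"
  then show "r \<in> (\<lambda>x. x \<bullet> e) ` C" using inner_scaleR_unit[of r] by (intro image_eqI[of _ _ "r *\<^sub>R e"]) auto
qed

lemma bounded_gap_of_is_gap:
  assumes g: "is_gap ((\<lambda>x. x \<bullet> e) ` C) p q"
  shows "{x. x \<bullet> e \<in> {p<..<q}} \<in> bounded_gaps C"
proof -
  let ?G = "{x. x \<bullet> e \<in> {p<..<q}}"
  have pq: "p < q" "p *\<^sub>R e \<in> C" "q *\<^sub>R e \<in> C" using g unfolding is_gap_def coordinate_mem by auto
  have sub: "?G \<subseteq> - C" using g unfolding is_gap_def by fastforce
  have img: "?G = (\<lambda>r. r *\<^sub>R e) ` {p<..<q}" by (rule coordinate_vimage)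
  have "path_connected ?G"
    unfolding img by (intro path_connected_continuous_image continuous_intros convex_imp_path_connected convex_real_interval)
  define x where "x = ((p + q) / 2) *\<^sub>R e"
  have x: "x \<in> ?G" using pq(1) by (simp add: x_def inner_unit)
  have 1: "?G \<subseteq> path_component_set (- C) x"
    by (rule path_component_maximal) fact+
  have conn: "connected ((\<lambda>x. x \<bullet> e) ` path_component_set (- C) x)"
    by (intro connected_continuous_image continuous_intros path_connected_imp_connected path_connected_path_component)
  have no: "r \<notin> (\<lambda>x. x \<bullet> e) ` path_component_set (- C) x" if "r *\<^sub>R e \<in> C" for r
    unfolding coordinate_mem using path_component_subset[of "- C" x] that by blast
  have xin: "x \<bullet> e \<in> (\<lambda>x. x \<bullet> e) ` path_component_set (- C) x" using 1 x by blast
  have xpq: "p < x \<bullet> e" "x \<bullet> e < q" using x by auto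
  have 2: "path_component_set (- C) x \<subseteq> ?G"
  proof
    fix z assume "z \<in> path_component_set (- C) x"
    then have z: "z \<bullet> e \<in> (\<lambda>x. x \<bullet> e) ` path_component_set (- C) x" by blast
    have "\<not> z \<bullet> e \<le> p" using connectedD_interval[OF conn z xin, of p] no[OF pq(2)] xpq by auto
    moreover have "\<not> q \<le> z \<bullet> e" using connectedD_interval[OF conn xin z, of q] no[OF pq(3)] xpq by auto
    ultimately show "z \<in> ?G" by simp
  qed
  have "?G = path_component_set (- C) x" using 1 2 by (rule equalityI)
  moreover have "x \<in> - C" using x sub by blast
  moreover have "bounded ?G"
  proof -
    have "bounded ((\<lambda>r. r *\<^sub>R e) ` {p<..<q})"
      by (intro bounded_linear_image bounded_linear_scaleR_left) simp
    then show ?thesis unfolding img .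
  qed
  ultimately show ?thesis by (simp add: bounded_gaps_def gaps_def)
qed

lemma ray_subset_unbounded_gap:
  assumes "\<And>x. x \<in> C \<Longrightarrow> x \<bullet> e \<le> M"
  shows "{x. x \<bullet> e \<in> {M<..}} \<subseteq> unbounded_gap C"
proof
  let ?R = "{x. x \<bullet> e \<in> {M<..}}"
  fix x assume x: "x \<in> ?R"
  have sub: "?R \<subseteq> - C" using assms by fastforce
  have img: "?R = (\<lambda>r. r *\<^sub>R e) ` {M<..}" by (rule coordinate_vimage)
  have "path_connected ?R"
    unfolding img by (intro path_connected_continuous_image continuous_intros convex_imp_path_connected convex_real_interval)
  then have R: "?R \<subseteq> path_component_set (- C) x" using x sub by (intro path_component_maximal)
  have "\<not> bounded ?R"
  proof
    assume "bounded ?R"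
    then obtain B where B: "\<And>x. x \<in> ?R \<Longrightarrow> norm x \<le> B" by (auto simp: bounded_iff)
    have "(\<bar>M\<bar> + \<bar>B\<bar> + 1) *\<^sub>R e \<in> ?R" by (simp add: inner_unit)
    from B[OF this] show False using unit by simp
  qed
  then have "\<not> bounded (path_component_set (- C) x)" using R bounded_subset by blast
  moreover have "path_component_set (- C) x \<in> gaps C" using x sub by (auto simp: gaps_def)
  ultimately show "x \<in> unbounded_gap C" using R x by (auto simp: unbounded_gap_def)
qed

end

text \<open>The endpoints of the gaps are in their closures, so that the distances between gaps bound the
  distances between endpoints from below.\<close>

lemma thick_coordinate_image:
  fixes C :: "'a::euclidean_space set"
  assumes rep: "\<And>x. (x \<bullet> e) *\<^sub>R e = x" and unit: "norm e = 1"
    and C: "compact C" "C \<noteq> {}" and t: "0 \<le> t" "ennreal t \<le> thickness C"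
  obtains m M where "thick t m M ((\<lambda>x. x \<bullet> e) ` C)"
proof -
  let ?S = "(\<lambda>x. x \<bullet> e) ` C" let ?G = "\<lambda>p q. {x. x \<bullet> e \<in> {p<..<q}}"
  have S: "compact ?S" using C by (intro compact_continuous_image continuous_intros)
  obtain m where m: "m \<in> ?S" "\<And>x. x \<in> ?S \<Longrightarrow> m \<le> x" using compact_attains_inf[OF S] C by blast
  obtain M where M: "M \<in> ?S" "\<And>x. x \<in> ?S \<Longrightarrow> x \<le> M" using compact_attains_sup[OF S] C by blast
  have gap: "?G p q \<in> bounded_gaps C" if "is_gap ?S p q" for p q
    by (rule bounded_gap_of_is_gap[OF rep unit that])
  have cl: "p *\<^sub>R e \<in> closure (?G p q)" "q *\<^sub>R e \<in> closure (?G p q)" if "is_gap ?S p q" for p q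
    by (rule closure_coordinate_vimage[OF rep unit]; use that in \<open>simp add: is_gap_def\<close>)+
  have dist: "dist (r *\<^sub>R e) (r' *\<^sub>R e) = \<bar>r - r'\<bar>" for r r'
    using dist_coordinate[OF rep unit, of "r *\<^sub>R e" "r' *\<^sub>R e"] inner_unit[OF rep unit] by simp
  have diam: "q - p \<le> diameter (?G p q)" if g: "is_gap ?S p q" for p q
  proof -
    have bd: "bounded (?G p q)" using gap[OF g] by (simp add: bounded_gaps_def)
    then have "dist (q *\<^sub>R e) (p *\<^sub>R e) \<le> diameter (closure (?G p q))"
      using cl[OF g] by (intro diameter_bounded_bound) auto
    then show ?thesis using diameter_closure[OF bd] unfolding dist by simp
  qed
  have closure_dist: "setdist A B \<le> \<bar>r - r'\<bar>" if "r *\<^sub>R e \<in> closure A" "r' *\<^sub>R e \<in> closure B" for A B r r'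
  proof -
    have "setdist A B = setdist (closure A) (closure B)" by simp
    also have "\<dots> \<le> dist (r *\<^sub>R e) (r' *\<^sub>R e)" using that by (rule setdist_le_dist)
    finally show ?thesis unfolding dist .
  qed
  have "thick t m M ?S"
    unfolding thick_def
  proof (intro conjI allI impI)
    show "compact ?S" "m \<in> ?S" "M \<in> ?S" "?S \<subseteq> {m..M}" using S m M by auto
  next
    fix p q assume g: "is_gap ?S p q"
    have "t * (q - p) \<le> t * diameter (?G p q)" using t(1) diam[OF g] by (rule mult_left_mono[rotated])
    also have "\<dots> \<le> setdist (?G p q) (unbounded_gap C)"
      by (rule thickness_gap_distances(1)[OF C(1) t gap[OF g]])
    finally have *: "t * (q - p) \<le> setdist (?G p q) (unbounded_gap C)" .
    have pq: "p \<in> ?S" "q \<in> ?S" using g by (auto simp: is_gap_def)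
    have "{x. x \<bullet> e \<in> {M<..}} \<subseteq> unbounded_gap C"
      by (rule ray_subset_unbounded_gap[OF rep unit]) (use M in auto)
    moreover have "M *\<^sub>R e \<in> closure {x. x \<bullet> e \<in> {M<..}}"
      by (rule closure_coordinate_vimage[OF rep unit]) simp
    ultimately have "M *\<^sub>R e \<in> closure (unbounded_gap C)" using closure_mono by blast
    from closure_dist[OF cl(2)[OF g] this] show "t * (q - p) \<le> M - q"
      using * M(2)[OF pq(2)] by simp
    have rep': "(x \<bullet> (- e)) *\<^sub>R (- e) = x" for x using rep by simp
    have unit': "norm (- e) = 1" using unit by simp
    have "{x. x \<bullet> (- e) \<in> {- m<..}} \<subseteq> unbounded_gap C"
      by (rule ray_subset_unbounded_gap[OF rep' unit']) (use m in auto)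
    moreover have "(- m) *\<^sub>R (- e) \<in> closure {x. x \<bullet> (- e) \<in> {- m<..}}"
      by (rule closure_coordinate_vimage[OF rep' unit']) simp
    ultimately have "(- m) *\<^sub>R (- e) \<in> closure (unbounded_gap C)" using closure_mono by blast
    then have "m *\<^sub>R e \<in> closure (unbounded_gap C)" by simp
    from closure_dist[OF cl(1)[OF g] this] show "t * (q - p) \<le> p - m"
      using * m(2)[OF pq(1)] by simp
  next
    fix p q p' q' assume g: "is_gap ?S p q" "is_gap ?S p' q'" "q \<le> p'"
    have pq: "p < q" "p' < q'" using g by (auto simp: is_gap_def)
    have "((p + q) / 2) *\<^sub>R e \<in> ?G p q" "((p + q) / 2) *\<^sub>R e \<notin> ?G p' q'"
      using pq g(3) by (simp_all add: inner_unit[OF rep unit])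
    then have ne: "?G p q \<noteq> ?G p' q'" by metis
    have "t * min (q - p) (q' - p') \<le> t * min (diameter (?G p q)) (diameter (?G p' q'))"
      using t(1) diam[OF g(1)] diam[OF g(2)] by (intro mult_left_mono) auto
    also have "\<dots> \<le> setdist (?G p q) (?G p' q')"
      by (rule thickness_gap_distances(2)[OF C(1) t gap[OF g(1)] gap[OF g(2)] ne])
    also have "\<dots> \<le> \<bar>q - p'\<bar>" by (rule closure_dist[OF cl(2)[OF g(1)] cl(1)[OF g(2)]])
    finally show "t * min (q - p) (q' - p') \<le> p' - q" using g(3) by simp
  qed
  then show ?thesis by (rule that)
qed

lemma interior_coordinate_image:
  fixes C :: "'a::euclidean_space set"
  assumes rep: "\<And>x. (x \<bullet> e) *\<^sub>R e = x" and unit: "norm e = 1" and int: "interior C = {}"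
  shows "interior ((\<lambda>x. x \<bullet> e) ` C) = {}"
proof (rule ccontr)
  let ?U = "interior ((\<lambda>x. x \<bullet> e) ` C)"
  assume "?U \<noteq> {}"
  then obtain r where r: "r \<in> ?U" by blast
  have "open {x. x \<bullet> e \<in> ?U}"
    using open_vimage[of ?U "\<lambda>x. x \<bullet> e"] by (simp add: vimage_def continuous_intros)
  moreover have "{x. x \<bullet> e \<in> ?U} \<subseteq> C"
  proof
    fix x assume "x \<in> {x. x \<bullet> e \<in> ?U}"
    then have "(x \<bullet> e) *\<^sub>R e \<in> C" using interior_subset coordinate_mem[OF rep unit] by blast
    then show "x \<in> C" using rep by simp
  qed
  moreover have "r *\<^sub>R e \<in> {x. x \<bullet> e \<in> ?U}" using r inner_unit[OF rep unit] by simp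
  ultimately show False using int interior_maximal by blast
qed

text \<open>Some gap lies between \<open>a\<close> and \<open>c\<close>, as the set has no interior.  Gaps accumulate at its right
  endpoint from the right, and so at theirs; there is no rightmost one.\<close>

lemma infinite_gap_endpoints:
  assumes S: "thick t m M S" "0 < t" "interior S = {}" and a: "a \<in> S" "a < c" "c \<in> S"
  shows "infinite {q. a < q \<and> (\<exists>p. is_gap S p q)}" (is "infinite ?Q")
proof
  assume fin: "finite ?Q"
  have "\<not> {a<..<c} \<subseteq> S"
  proof
    assume "{a<..<c} \<subseteq> S"
    then have "{a<..<c} \<subseteq> interior S" by (simp add: interior_maximal)
    moreover have "(a + c) / 2 \<in> {a<..<c}" using a by auto
    ultimately show False using S(3) by blast
  qed
  then obtain x where "x \<in> {a<..<c}" "x \<notin> S" by blast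
  then have x: "a < x" "x < c" "x \<notin> S" by auto
  obtain p q where "is_gap S p q" "x < q"
    using gap_around[OF thickD(1)[OF S(1)] a(1) x(1) a(3) x(2,3)] by blast
  then have "q \<in> ?Q" using x by auto
  then have "Max ?Q \<in> ?Q" using fin by (intro Max_in) auto
  then obtain p' where p': "is_gap S p' (Max ?Q)" "a < Max ?Q" by auto
  obtain r r' where r: "is_gap S r r'" "Max ?Q < r" "r' < Max ?Q + 1"
    by (rule gaps_accumulate_right[OF S(1-3) p'(1) zero_less_one])
  have "r < r'" using r by (simp add: is_gap_def)
  then have "r' \<in> ?Q" using r p'(2) by (intro CollectI conjI exI[of _ r]) auto
  then show False using Max_ge[OF fin] r(2) \<open>r < r'\<close> by fastforce
qed

text \<open>The complement of a single point has no bounded component: a ray from the point through any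
  other point leaves every bounded set.\<close>

lemma two_points_if_bounded_gap:
  fixes C :: "'a::euclidean_space set"
  assumes C: "compact C" and gaps: "bounded_gaps C \<noteq> {}" and a: "a \<in> C"
  obtains c where "c \<in> C" "a \<noteq> c"
proof -
  obtain G where "G \<in> bounded_gaps C" using gaps by blast
  then have G: "G \<in> gaps C" "bounded G" by (auto simp: bounded_gaps_def)
  note gap = gap_properties[OF C G(1)]
  obtain g where g: "g \<in> G" using gap(3) by blast
  have ga: "g - a \<noteq> 0" using g gap(4) a by auto
  let ?R = "(\<lambda>s. a + s *\<^sub>R (g - a)) ` {0<..}"
  have "\<not> bounded ?R"
  proof
    assume "bounded ?R"
    then obtain B where B: "\<And>s. 0 < s \<Longrightarrow> norm (a + s *\<^sub>R (g - a)) \<le> B" by (auto simp: bounded_iff)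
    define s where "s = (norm a + \<bar>B\<bar> + 1) / norm (g - a)"
    have "0 < norm a + \<bar>B\<bar> + 1" using norm_ge_zero[of a] by linarith
    then have s: "0 < s" "s * norm (g - a) = norm a + \<bar>B\<bar> + 1" using ga by (auto simp: s_def)
    have "norm (s *\<^sub>R (g - a)) \<le> norm (a + s *\<^sub>R (g - a)) + norm a"
      using norm_triangle_ineq4[of "a + s *\<^sub>R (g - a)" a] by simp
    then show False using B[OF s(1)] s by simp
  qed
  then have "?R - G \<noteq> {}" using G(2) bounded_subset by blast
  moreover have "g \<in> ?R" by (intro image_eqI[of _ _ 1]) auto
  then have "?R \<inter> G \<noteq> {}" using g by blast
  moreover have "connected ?R" by (intro connected_continuous_image continuous_intros) simp
  ultimately obtain s where s: "0 < s" "a + s *\<^sub>R (g - a) \<in> frontier G"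
    using connected_Int_frontier[of ?R G] by auto
  then have "a + s *\<^sub>R (g - a) \<in> C" using gap(5) by blast
  moreover have "a \<noteq> a + s *\<^sub>R (g - a)" using s(1) ga by simp
  ultimately show ?thesis by (rule that)
qed

lemma robustly_leaves_dim_1:
  fixes C1 C2 :: "'a::euclidean_space set"
  assumes dim: "DIM('a) = 1" and C: "compact C1" "compact C2" and th: "1 < thickness C1 * thickness C2"
  shows "robustly_leaves (C1 \<times> C2)"
proof (cases "interior C1 = {} \<and> interior C2 = {}")
  case False
  then show ?thesis using robustly_leaves_if_interior robustly_leaves_swap by blast
next
  case True
  then have int: "interior C1 = {}" "interior C2 = {}" by auto
  have "thickness C1 \<noteq> 0" "thickness C2 \<noteq> 0" using th by auto
  then have pos: "0 < thickness C1" "0 < thickness C2" by (simp_all add: zero_less_iff_neq_zero)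
  then have gaps: "bounded_gaps C1 \<noteq> {}" "bounded_gaps C2 \<noteq> {}" using int by (auto simp: thickness_def)
  obtain t1 where t1: "0 < t1" "ennreal t1 = thickness C1"
    by (rule finite_positive_thickness[OF C(1) int(1) pos(1)])
  obtain t2 where t2: "0 < t2" "ennreal t2 = thickness C2"
    by (rule finite_positive_thickness[OF C(2) int(2) pos(2)])
  have "1 < ennreal (t1 * t2)" using th t1 t2 by (simp add: ennreal_mult)
  then have t12: "1 < t1 * t2" by (simp add: one_less_ennreal)
  show ?thesis
    unfolding robustly_leaves_def
  proof (intro ballI allI impI)
    fix y F assume "y \<in> C1 \<times> C2" and F: "finite (F :: ('a \<times> 'a) set)"
    then obtain a b where ab: "y = (a, b)" "a \<in> C1" "b \<in> C2" by blast
    obtain c where c: "c \<in> C1" "a \<noteq> c" by (rule two_points_if_bounded_gap[OF C(1) gaps(1) ab(2)])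
    obtain d where d: "d \<in> C2" "b \<noteq> d" by (rule two_points_if_bounded_gap[OF C(2) gaps(2) ab(3)])
    obtain e1 :: 'a where e1: "\<And>x. (x \<bullet> e1) *\<^sub>R e1 = x" "norm e1 = 1" "a \<bullet> e1 < c \<bullet> e1"
      using line_coordinate[OF dim c(2)] by metis
    obtain e2 :: 'a where e2: "\<And>x. (x \<bullet> e2) *\<^sub>R e2 = x" "norm e2 = 1" "b \<bullet> e2 < d \<bullet> e2"
      using line_coordinate[OF dim d(2)] by metis
    let ?S1 = "(\<lambda>x. x \<bullet> e1) ` C1" let ?S2 = "(\<lambda>x. x \<bullet> e2) ` C2"
    obtain m1 M1 where S1: "thick t1 m1 M1 ?S1"
      using thick_coordinate_image[OF e1(1,2) C(1), of t1] c t1 by auto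
    obtain m2 M2 where S2: "thick t2 m2 M2 ?S2"
      using thick_coordinate_image[OF e2(1,2) C(2), of t2] d t2 by auto
    have int1: "interior ?S1 = {}" by (rule interior_coordinate_image[OF e1(1,2) int(1)])
    have int2: "interior ?S2 = {}" by (rule interior_coordinate_image[OF e2(1,2) int(2)])
    have "infinite ({q. a \<bullet> e1 < q \<and> (\<exists>p. is_gap ?S1 p q)} - (\<lambda>x. x \<bullet> e1) ` fst ` F)"
      using infinite_gap_endpoints[OF S1 t1(1) int1 imageI[OF ab(2)] e1(3) imageI[OF c(1)]] F
      by (simp add: Diff_infinite_finite)
    then obtain p1 q1 where q1: "a \<bullet> e1 < q1" "is_gap ?S1 p1 q1" "q1 \<notin> (\<lambda>x. x \<bullet> e1) ` fst ` F"
      using infinite_imp_nonempty by blast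
    obtain p2 q2 where q2: "b \<bullet> e2 < q2" "is_gap ?S2 p2 q2"
      using infinite_gap_endpoints[OF S2 t2(1) int2 imageI[OF ab(3)] e2(3) imageI[OF d(1)]]
        infinite_imp_nonempty by blast
    have "robustly_reaches (C1 \<times> C2) (a, b) (q1 *\<^sub>R e1, q2 *\<^sub>R e2)"
      unfolding robustly_reaches_def
    proof (intro allI impI)
      fix \<epsilon> :: real assume \<epsilon>: "0 < \<epsilon>"
      have "0 < \<epsilon> / 2" using \<epsilon> by simp
      let ?P = "\<lambda>z. 0 < snd z \<and> (\<exists>u\<in>?S1. \<exists>v\<in>?S2. \<bar>u - q1\<bar> < \<epsilon> / 2 \<and> \<bar>v - q2\<bar> < \<epsilon> / 2 \<and>
          (u - fst (fst z))\<^sup>2 + (v - snd (fst z))\<^sup>2 = (snd z)\<^sup>2)"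
      let ?f = "\<lambda>z::('a \<times> 'a) \<times> real. ((fst (fst z) \<bullet> e1, snd (fst z) \<bullet> e2), snd z)"
      obtain s where s: "\<forall>\<^sub>F z in nhds ((a \<bullet> e1, b \<bullet> e2), s). ?P z"
        by (rule sum_of_squares_near_gap_endpoints
            [OF S1 int1 q1(2,1) S2 int2 q2(2,1) t1(1) t2(1) t12 \<open>0 < \<epsilon> / 2\<close>])
      have "(?f \<longlongrightarrow> ?f ((a, b), s)) (nhds ((a, b), s))"
        by (intro tendsto_Pair tendsto_fst tendsto_snd tendsto_inner filterlim_ident tendsto_const)
      then have "filterlim ?f (nhds ((a \<bullet> e1, b \<bullet> e2), s)) (nhds ((a, b), s))" by simp
      from eventually_compose_filterlim[OF s this]
      have "\<forall>\<^sub>F (y', s') in nhds ((a, b), s). \<exists>z'\<in>C1 \<times> C2. dist (q1 *\<^sub>R e1, q2 *\<^sub>R e2) z' < \<epsilon> \<and> dist y' z' = s'"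
      proof (rule eventually_mono)
        fix w assume w: "?P (?f w)"
        obtain a' b' s' where w_eq: "w = ((a', b'), s')" by (metis surj_pair)
        obtain u v where uv: "u \<in> ?S1" "v \<in> ?S2" "\<bar>u - q1\<bar> < \<epsilon> / 2" "\<bar>v - q2\<bar> < \<epsilon> / 2"
            "(u - a' \<bullet> e1)\<^sup>2 + (v - b' \<bullet> e2)\<^sup>2 = s'\<^sup>2" and s': "0 < s'"
          using w unfolding w_eq by auto
        let ?z = "(u *\<^sub>R e1, v *\<^sub>R e2)"
        have d1: "dist x (r *\<^sub>R e1) = \<bar>r - x \<bullet> e1\<bar>" for x r
          using dist_coordinate[OF e1(1,2), of x "r *\<^sub>R e1"] by (simp add: inner_unit[OF e1(1,2)] abs_minus_commute)
        have d2: "dist x (r *\<^sub>R e2) = \<bar>r - x \<bullet> e2\<bar>" for x r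
          using dist_coordinate[OF e2(1,2), of x "r *\<^sub>R e2"] by (simp add: inner_unit[OF e2(1,2)] abs_minus_commute)
        have "dist (a', b') ?z = sqrt ((u - a' \<bullet> e1)\<^sup>2 + (v - b' \<bullet> e2)\<^sup>2)"
          by (simp add: dist_Pair_Pair d1 d2)
        then have "dist (a', b') ?z = s'" using uv(5) s' by simp
        moreover have "dist (q1 *\<^sub>R e1, q2 *\<^sub>R e2) ?z = sqrt ((u - q1)\<^sup>2 + (v - q2)\<^sup>2)"
          by (simp add: dist_Pair_Pair d1 d2 inner_unit[OF e1(1,2)] inner_unit[OF e2(1,2)])
        then have "dist (q1 *\<^sub>R e1, q2 *\<^sub>R e2) ?z < \<epsilon>"
          using sqrt_sum_squares_le_sum_abs[of "u - q1" "v - q2"] uv(3,4) by linarith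
        moreover have "?z \<in> C1 \<times> C2"
          using uv(1,2) unfolding coordinate_mem[OF e1(1,2)] coordinate_mem[OF e2(1,2)] by (rule SigmaI)
        ultimately show "case w of (y', s') \<Rightarrow> \<exists>z'\<in>C1 \<times> C2. dist (q1 *\<^sub>R e1, q2 *\<^sub>R e2) z' < \<epsilon> \<and> dist y' z' = s'"
          unfolding w_eq prod.case by (intro bexI[of _ ?z] conjI)
      qed
      then show "\<exists>s. \<forall>\<^sub>F (y', s') in nhds ((a, b), s). \<exists>z'\<in>C1 \<times> C2. dist (q1 *\<^sub>R e1, q2 *\<^sub>R e2) z' < \<epsilon> \<and> dist y' z' = s'"
        by blast
    qed
    moreover have "(q1 *\<^sub>R e1, q2 *\<^sub>R e2) \<in> C1 \<times> C2 - F"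
    proof -
      have "q1 *\<^sub>R e1 \<in> C1" "q2 *\<^sub>R e2 \<in> C2"
        using q1(2) q2(2) unfolding is_gap_def coordinate_mem[OF e1(1,2)] coordinate_mem[OF e2(1,2)] by auto
      moreover have "(q1 *\<^sub>R e1, q2 *\<^sub>R e2) \<notin> F"
      proof
        assume "(q1 *\<^sub>R e1, q2 *\<^sub>R e2) \<in> F"
        then have "(q1 *\<^sub>R e1) \<bullet> e1 \<in> (\<lambda>x. x \<bullet> e1) ` fst ` F" by force
        then show False using q1(3) unfolding inner_scaleR_unit[OF e1(1,2)] by blast
      qed
      ultimately show ?thesis by blast
    qed
    ultimately show "\<exists>z\<in>C1 \<times> C2 - F. robustly_reaches (C1 \<times> C2) y z" unfolding ab(1) by blast
  qed
qed

section \<open>Pinned tree distance sets\<close>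

theorem theorem1p10:
  fixes C1 C2 :: "'a::euclidean_space set"
  assumes "compact C1" and "compact C2"
    and "thickness C1 * thickness C2 > 1"
  shows "\<forall>k\<ge>1. \<forall>adj. tree {1..k+1} adj \<longrightarrow>
           (\<forall>x \<in> C1 \<times> C2.
              powertop_real (graph_edges adj) interior_of
                pinned_tree_distance_set k adj x (C1 \<times> C2) \<noteq> {})"
proof (intro allI impI ballI)
  fix k :: nat and adj x
  assume tree: "tree {1..k+1} adj" and x: "x \<in> C1 \<times> C2"
  have "thickness C1 \<noteq> 0" using assms(3) by auto
  then have pos: "0 < thickness C1" by (simp add: zero_less_iff_neq_zero)
  have leaves: "robustly_leaves (C1 \<times> C2)"
  proof (cases "DIM('a) = 1")
    case True
    then show ?thesis by (rule robustly_leaves_dim_1[OF _ assms])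
  next
    case False
    then have "2 \<le> DIM('a)" using DIM_positive[where 'a = 'a] by linarith
    then show ?thesis by (rule robustly_leaves_dim_ge_2[OF _ assms(1) pos])
  qed
  show "powertop_real (graph_edges adj) interior_of pinned_tree_distance_set k adj x (C1 \<times> C2) \<noteq> {}"
    by (rule pinned_tree_distance_set_interior[OF tree x leaves])
qed

end
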